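(* Let $\Bbbk$ be an infinite field, $\mathcal{P}=\Bbbk[x_1,\dots,x_n]$, and let $\mathcal{I}\subset\mathcal{P}$ be a nonzero proper homogeneous ideal of dimension $D=\dim(\mathcal{P}/\mathcal{I})$ possessing a (finite) Pommaret basis $\mathcal{H}$ with respect to the degree reverse lexicographic order with $x_n\prec\cdots\prec x_1$. Write the Hilbert series of $\mathcal{I}$ as $\mathrm{HS}_{\mathcal{I}}(t)=N(t)/(1-t)^D$ where $N(t)=a_0+a_1t+\cdots+a_\ell t^\ell$ is a polynomial with $a_\ell\neq 0$. Then $\deg(N)=\ell$ satisfies $$\ell\le\max\{\deg(h)-|\mathcal{X}_P(h)|+D\mid h\in\mathcal{H}\}$$ and the coefficients $a_i$ are given by $$a_i=\binom{n-D+i-1}{n-D-1}-\sum_{\substack{h\in\mathcal{H},\ \deg(h)\le i,\\ |\mathcal{X}_P(h)|\le D}}(-1)^{i-\deg(h)}\binom{D-|\mathcal{X}_P(h)|}{i-\deg(h)}-\sum_{\substack{h\in\mathcal{H},\ \deg(h)\le i,\\ |\mathcal{X}_P(h)|>D}}\binom{|\mathcal{X}_P(h)|-D+i-\deg(h)-1}{|\mathcal{X}_P(h)|-D-1}.$$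
   Context: $\mathrm{LT}$ denotes the leading term (without coefficient) with respect to the degree reverse lexicographic order with $x_n\prec\cdots\prec x_1$, and $\mathrm{LT}(\mathcal{I})$ is the leading ideal. For $0\ne f\in\mathcal{P}$ with $\mathrm{LT}(f)=x^\alpha$, $\alpha\neq 0$, the class of $f$ is $\mathrm{cls}(f)=\max\{i\mid \alpha_i\ne 0\}$ and its set of multiplicative variables is $\mathcal{X}_P(f)=\{x_{\mathrm{cls}(f)},\dots,x_n\}$ (so $|\mathcal{X}_P(f)|=n-\mathrm{cls}(f)+1$). The term $x^\beta$ is a Pommaret divisor of $x^\alpha$ if $x^\beta\mid x^\alpha$ and $x^{\alpha-\beta}\in\Bbbk[\mathcal{X}_P(x^\beta)]$. A finite set $\mathcal{H}\subset\mathcal{I}$ of nonzero homogeneous polynomials is a Pommaret basis of $\mathcal{I}$ if no leading term of an element of $\mathcal{H}$ is a Pommaret divisor of the leading term of another element and $\bigoplus_{h\in\mathcal{H}}\Bbbk[\mathcal{X}_P(h)]\cdot\mathrm{LT}(h)=\mathrm{LT}(\mathcal{I})$. $D=\dim(\mathcal{I})$ is the Krull dimension of $\mathcal{P}/\mathcal{I}$. The Hilbert series is $\mathrm{HS}_{\mathcal{I}}(t)=\sum_{s\ge0}\dim_{\Bbbk}\bigl((\mathcal{P}/\mathcal{I})_s\bigr)t^s$; it is known to be of the form $N(t)/(1-t)^D$ with $N$ a polynomial satisfying $N(1)\neq0$. *)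

theory Defs
  imports
    "HOL-Algebra.Algebraic_Closure_Type"
    "HOL-Algebra.QuotRing"
    "HOL-Algebra.Embedded_Algebras"
    "HOL-Library.Poly_Mapping"
    "HOL-Library.Cardinality"
    "HOL-Library.Extended_Nat"
    "HOL-Library.FuncSet"
    "HOL-Computational_Algebra.Formal_Power_Series"
    "HOL-Computational_Algebra.Polynomial_FPS"
begin

text \<open>
  The variables \<open>x\<^sub>1, \<dots>, x\<^sub>n\<close> are indexed by the elements, in increasing order, of a finite
  linearly ordered type \<open>'n\<close> with \<open>n = CARD('n)\<close>. A term \<open>x\<^sup>\<alpha>\<close> is represented by its exponent
  vector \<open>\<alpha>\<close>; as a polynomial it is \<open>Poly_Mapping.single \<alpha> 1\<close>.
\<close>

type_synonym 'n expo = "'n \<Rightarrow>\<^sub>0 nat"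
type_synonym ('n, 'k) mpoly = "'n expo \<Rightarrow>\<^sub>0 'k"

abbreviation poly_ring :: "('n::{finite,linorder}, 'k::field) mpoly ring"
  where "poly_ring \<equiv> ring_of_type_algebra"


subsection \<open>Degrees and homogeneous ideals\<close>

definition mdeg :: "'n::{finite,linorder} expo \<Rightarrow> nat"
  where "mdeg \<alpha> = (\<Sum>i\<in>UNIV. Poly_Mapping.lookup \<alpha> i)"

definition poly_deg :: "('n::{finite,linorder}, 'k::field) mpoly \<Rightarrow> nat"
  where "poly_deg f = Max (mdeg ` Poly_Mapping.keys f)"

definition homogeneous :: "nat \<Rightarrow> ('n::{finite,linorder}, 'k::field) mpoly \<Rightarrow> bool"
  where "homogeneous s f \<longleftrightarrow> (\<forall>\<alpha>\<in>Poly_Mapping.keys f. mdeg \<alpha> = s)"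

definition hom_comp :: "nat \<Rightarrow> ('n::{finite,linorder}, 'k::field) mpoly \<Rightarrow> ('n, 'k) mpoly"
  where "hom_comp s f =
    (\<Sum>\<alpha>\<in>{\<alpha> \<in> Poly_Mapping.keys f. mdeg \<alpha> = s}.
      Poly_Mapping.single \<alpha> (Poly_Mapping.lookup f \<alpha>))"

definition homogeneous_ideal :: "('n::{finite,linorder}, 'k::field) mpoly set \<Rightarrow> bool"
  where "homogeneous_ideal I \<longleftrightarrow> ideal I poly_ring \<and> (\<forall>f\<in>I. \<forall>s. hom_comp s f \<in> I)"


subsection \<open>Leading terms\<close>

text \<open>
  In equal degree, \<open>\<alpha>\<close> is smaller than \<open>\<beta>\<close> if the last nonzero entry of \<open>\<alpha> - \<beta>\<close> is positive;
  in particular a variable with larger index is smaller.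
\<close>

definition degrevlex :: "'n::{finite,linorder} expo \<Rightarrow> 'n expo \<Rightarrow> bool"  (infix \<open>\<prec>drl\<close> 50)
  where "\<alpha> \<prec>drl \<beta> \<longleftrightarrow> mdeg \<alpha> < mdeg \<beta> \<or>
    (mdeg \<alpha> = mdeg \<beta> \<and> (\<exists>i.
      Poly_Mapping.lookup \<beta> i < Poly_Mapping.lookup \<alpha> i \<and>
      (\<forall>j>i. Poly_Mapping.lookup \<alpha> j = Poly_Mapping.lookup \<beta> j)))"

definition LT :: "('n::{finite,linorder}, 'k::field) mpoly \<Rightarrow> 'n expo"
  where "LT f =
    (THE \<alpha>. \<alpha> \<in> Poly_Mapping.keys f \<and> (\<forall>\<beta>\<in>Poly_Mapping.keys f. \<beta> \<noteq> \<alpha> \<longrightarrow> \<beta> \<prec>drl \<alpha>))"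

definition leading_ideal :: "('n::{finite,linorder}, 'k::field) mpoly set \<Rightarrow> ('n, 'k) mpoly set"
  where "leading_ideal I = Idl\<^bsub>poly_ring\<^esub> {Poly_Mapping.single (LT f) 1 | f. f \<in> I \<and> f \<noteq> 0}"


subsection \<open>Pommaret bases\<close>

text \<open>Only meaningful for terms other than \<open>1\<close>.\<close>

definition cls :: "'n::{finite,linorder} expo \<Rightarrow> 'n"
  where "cls \<alpha> = Max (Poly_Mapping.keys \<alpha>)"

definition mult_vars_term :: "'n::{finite,linorder} expo \<Rightarrow> 'n set"
  where "mult_vars_term \<alpha> = {i. cls \<alpha> \<le> i}"

definition mult_vars :: "('n::{finite,linorder}, 'k::field) mpoly \<Rightarrow> 'n set"
  where "mult_vars f = mult_vars_term (LT f)"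

definition pommaret_divisor :: "'n::{finite,linorder} expo \<Rightarrow> 'n expo \<Rightarrow> bool"
  where "pommaret_divisor \<beta> \<alpha> \<longleftrightarrow> (\<exists>\<gamma>. \<alpha> = \<beta> + \<gamma> \<and> Poly_Mapping.keys \<gamma> \<subseteq> mult_vars_term \<beta>)"

definition polys_in :: "'n::{finite,linorder} set \<Rightarrow> ('n, 'k::field) mpoly set"
  where "polys_in U = {g. \<forall>\<alpha>\<in>Poly_Mapping.keys g. Poly_Mapping.keys \<alpha> \<subseteq> U}"

text \<open>
  \<open>W\<close> is the internal direct sum of the finite family \<open>V\<close> of additive subgroups: every element of
  \<open>W\<close> is a sum of elements of the \<open>V a\<close> in exactly one way, and all such sums lie in \<open>W\<close>.
\<close>

definition is_direct_sum :: "'a set \<Rightarrow> ('a \<Rightarrow> 'b::ab_group_add set) \<Rightarrow> 'b set \<Rightarrow> bool"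
  where "is_direct_sum A V W \<longleftrightarrow> bij_betw (\<lambda>v. \<Sum>a\<in>A. v a) (\<Pi>\<^sub>E a\<in>A. V a) W"

definition pommaret_basis ::
    "('n::{finite,linorder}, 'k::field) mpoly set \<Rightarrow> ('n, 'k) mpoly set \<Rightarrow> bool"
  where "pommaret_basis H I \<longleftrightarrow>
    finite H \<and> H \<subseteq> I \<and> (\<forall>h\<in>H. h \<noteq> 0 \<and> (\<exists>s. homogeneous s h)) \<and>
    (\<forall>h\<in>H. \<forall>h'\<in>H. h \<noteq> h' \<longrightarrow> \<not> pommaret_divisor (LT h) (LT h')) \<and>
    is_direct_sum H (\<lambda>h. {g * Poly_Mapping.single (LT h) 1 | g. g \<in> polys_in (mult_vars h)})
      (leading_ideal I)"


subsection \<open>Krull dimension and Hilbert series\<close>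

text \<open>The supremum is \<open>0\<close> for the zero ring, which has no prime ideals.\<close>

definition krull_dim :: "('a, 'b) ring_scheme \<Rightarrow> enat"
  where "krull_dim R = Sup {enat d | d p.
    (\<forall>i\<le>d. primeideal (p i) R) \<and> (\<forall>i<d. p i \<subset> p (Suc i))}"

definition ideal_dim :: "('n::{finite,linorder}, 'k::field) mpoly set \<Rightarrow> enat"
  where "ideal_dim I = krull_dim (poly_ring Quot I)"

text \<open>
  The ground field, embedded into the quotient ring as the classes of constants, and the
  component of degree \<open>s\<close> of the quotient ring.
\<close>

definition quot_scalars :: "('n::{finite,linorder}, 'k::field) mpoly set \<Rightarrow> ('n, 'k) mpoly set set"
  where "quot_scalars I = {I +>\<^bsub>poly_ring\<^esub> Poly_Mapping.single 0 c | c. True}"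

definition quot_comp ::
    "('n::{finite,linorder}, 'k::field) mpoly set \<Rightarrow> nat \<Rightarrow> ('n, 'k) mpoly set set"
  where "quot_comp I s = {I +>\<^bsub>poly_ring\<^esub> f | f. homogeneous s f}"

definition hilbert_function :: "('n::{finite,linorder}, 'k::field) mpoly set \<Rightarrow> nat \<Rightarrow> nat"
  where "hilbert_function I s = ring.dim (poly_ring Quot I) (quot_scalars I) (quot_comp I s)"

definition hilbert_series :: "('n::{finite,linorder}, 'k::field) mpoly set \<Rightarrow> rat fps"
  where "hilbert_series I = Abs_fps (\<lambda>s. of_nat (hilbert_function I s))"

end

theory Submission
  imports Defs
begin

text \<open>
  Since \<open>H\<close> induces a decomposition of the monomials of the leading ideal into disjoint cones, counting
  monomials gives \<open>HS(t) = 1 / (1 - t) ^ n - (\<Sum>h. t ^ deg h / (1 - t) ^ |X h|)\<close>. Multiplying by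
  \<open>(1 - t) ^ D\<close> yields the coefficients of \<open>N\<close>, and multiplying by \<open>(1 - t) ^ n\<close> yields an equation of
  polynomials whose degrees bound \<open>deg N\<close>.

  Both uses need \<open>D < n\<close>. For a chain of primes \<open>0 = q\<^sub>0 \<subset> q\<^sub>1 \<subset> \<dots> \<subset> q\<^sub>m\<close> and \<open>f\<^sub>i \<in> q\<^sub>i - q\<^sub>i\<^sub>-\<^sub>1\<close>, the \<open>f\<^sub>i\<close> are
  algebraically independent over the field, whereas by a dimension count more than \<open>n\<close> polynomials in
  \<open>n\<close> variables are not. A chain of primes over the nonzero ideal \<open>I\<close> can be extended by \<open>0\<close>.
\<close>


section \<open>The dimension of a nonzero ideal\<close>

lemma carrier_type_algebra [simp]: "carrier ring_of_type_algebra = UNIV"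
  and mult_type_algebra [simp]: "x \<otimes>\<^bsub>ring_of_type_algebra\<^esub> y = x * y"
  and one_type_algebra [simp]: "\<one>\<^bsub>ring_of_type_algebra\<^esub> = 1"
  and zero_type_algebra [simp]: "\<zero>\<^bsub>ring_of_type_algebra\<^esub> = 0"
  and add_type_algebra [simp]: "x \<oplus>\<^bsub>ring_of_type_algebra\<^esub> y = x + y"
  by (simp_all add: ring_of_type_algebra_def)

lemma ideal_type_algebraD:
  fixes J :: "'a::comm_ring_1 set"
  assumes "ideal J ring_of_type_algebra"
  shows "0 \<in> J"
    and "x \<in> J \<Longrightarrow> y \<in> J \<Longrightarrow> x + y \<in> J"
    and "x \<in> J \<Longrightarrow> r * x \<in> J"
    and "x \<in> J \<Longrightarrow> y \<in> J \<Longrightarrow> x - y \<in> J"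
    and "finite B \<Longrightarrow> (\<And>b. b \<in> B \<Longrightarrow> g b \<in> J) \<Longrightarrow> sum g B \<in> J"
proof -
  interpret J: ideal J ring_of_type_algebra by fact
  show 0: "0 \<in> J"
    using additive_subgroup.zero_closed[OF J.additive_subgroup_axioms] by simp
  show add: "x \<in> J \<Longrightarrow> y \<in> J \<Longrightarrow> x + y \<in> J" for x y
    using additive_subgroup.a_closed[OF J.additive_subgroup_axioms, of x y] by simp
  show mult: "x \<in> J \<Longrightarrow> r * x \<in> J" for x r
    using J.I_l_closed by simp
  show "x \<in> J \<Longrightarrow> y \<in> J \<Longrightarrow> x - y \<in> J"
    using add[of x "- y"] mult[of y "- 1"] by simp
  show "finite B \<Longrightarrow> (\<And>b. b \<in> B \<Longrightarrow> g b \<in> J) \<Longrightarrow> sum g B \<in> J"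
    by (induction B rule: finite_induct) (auto intro: 0 add)
qed

lemma primeideal_type_algebraD:
  fixes J :: "'a::comm_ring_1 set"
  assumes "primeideal J ring_of_type_algebra"
  shows "1 \<notin> J" and "x * y \<in> J \<Longrightarrow> x \<in> J \<or> y \<in> J" and "x ^ n \<in> J \<Longrightarrow> x \<in> J"
proof -
  interpret J: primeideal J ring_of_type_algebra by fact
  show 1: "1 \<notin> J"
    using J.one_imp_carrier J.I_notcarr by auto
  show prime: "x * y \<in> J \<Longrightarrow> x \<in> J \<or> y \<in> J" for x y
    using J.I_prime[of x y] by simp
  show "x ^ n \<in> J \<Longrightarrow> x \<in> J"
    by (induction n) (use 1 prime in auto)
qed

text \<open>
  Let \<open>\<mu>\<close> be the least exponent of \<open>f k\<close>. As \<open>Q k\<close> is prime, the factor \<open>f k ^ \<mu>\<close> may be cancelled;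
  modulo \<open>Q (Suc k)\<close> only the summands with \<open>a k = \<mu>\<close> remain.
\<close>

lemma prime_chain_monomials_notin:
  fixes Q :: "nat \<Rightarrow> 'a::comm_ring_1 set" and c :: "(nat \<Rightarrow> nat) \<Rightarrow> 'a"
  assumes prime: "\<And>i. i \<le> m \<Longrightarrow> primeideal (Q i) ring_of_type_algebra"
    and sub: "\<And>i. i < m \<Longrightarrow> Q i \<subseteq> Q (Suc i)"
    and f: "\<And>i. i < m \<Longrightarrow> f i \<in> Q (Suc i)" "\<And>i. i < m \<Longrightarrow> f i \<notin> Q i"
    and "k \<le> m" "finite S" "S \<noteq> {}"
    and "\<And>a b. a \<in> S \<Longrightarrow> b \<in> S \<Longrightarrow> (\<And>i. k \<le> i \<Longrightarrow> i < m \<Longrightarrow> a i = b i) \<Longrightarrow> a = b"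
    and "\<And>a. a \<in> S \<Longrightarrow> c a \<notin> Q m"
  shows "(\<Sum>a\<in>S. c a * (\<Prod>i\<in>{k..<m}. f i ^ a i)) \<notin> Q k"
  using assms(5-)
proof (induction k arbitrary: S rule: inc_induct)
  \<comment> \<open>At k = m the distinctness hypothesis says that any two members of
    \<open>S\<close> are equal, so the sum is a single coefficient.\<close>
  case base
  then obtain a where "a \<in> S" by blast
  with base have "S = {a}" by auto
  with base show ?case by simp
next
  case (step k)
  have pk: "primeideal (Q k) ring_of_type_algebra" and pSk: "primeideal (Q (Suc k)) ring_of_type_algebra"
    using prime step.hyps by simp_all
  note Jk = ideal_type_algebraD[OF primeideal.axioms(1)[OF pk]]
  note JSk = ideal_type_algebraD[OF primeideal.axioms(1)[OF pSk]]
  define \<mu> where "\<mu> = Min ((\<lambda>a. a k) ` S)"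
  have \<mu>_le: "\<mu> \<le> a k" if "a \<in> S" for a
    using that step.prems by (simp add: \<mu>_def)
  have "\<mu> \<in> (\<lambda>a. a k) ` S"
    unfolding \<mu>_def using step.prems by (intro Min_in) auto
  define S' where "S' = {a \<in> S. a k = \<mu>}"
  define p where "p a = c a * (\<Prod>i\<in>{Suc k..<m}. f i ^ a i)" for a
  have notin: "sum p S' \<notin> Q (Suc k)"
    unfolding p_def
  proof (rule step.IH)
    show "S' \<noteq> {}" using \<open>\<mu> \<in> _\<close> by (auto simp: S'_def)
    \<comment> \<open>All members of \<open>S'\<close> have exponent \<mu> at k, so agreement from
      \<open>Suc k\<close> on is agreement from k on.\<close>
    show "a = b" if "a \<in> S'" "b \<in> S'" "\<And>i. Suc k \<le> i \<Longrightarrow> i < m \<Longrightarrow> a i = b i" for a b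
    proof (rule step.prems(3))
      show "a i = b i" if "k \<le> i" "i < m" for i
        using that \<open>a \<in> S'\<close> \<open>b \<in> S'\<close> \<open>\<And>i. Suc k \<le> i \<Longrightarrow> i < m \<Longrightarrow> a i = b i\<close>
        by (cases "i = k") (auto simp: S'_def)
    qed (use that in \<open>auto simp: S'_def\<close>)
  qed (use step.prems in \<open>auto simp: S'_def\<close>)
  have "(\<Sum>a\<in>S. c a * (\<Prod>i\<in>{k..<m}. f i ^ a i)) = f k ^ \<mu> * (\<Sum>a\<in>S. f k ^ (a k - \<mu>) * p a)"
    unfolding sum_distrib_left
  proof (rule sum.cong)
    fix a assume "a \<in> S"
    then have "f k ^ a k = f k ^ \<mu> * f k ^ (a k - \<mu>)"
      using \<mu>_le by (simp flip: power_add)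
    then show "c a * (\<Prod>i\<in>{k..<m}. f i ^ a i) = f k ^ \<mu> * (f k ^ (a k - \<mu>) * p a)"
      using step.hyps by (simp add: p_def prod.atLeast_Suc_lessThan mult_ac)
  qed simp
  moreover have "(\<Sum>a\<in>S. f k ^ (a k - \<mu>) * p a) \<notin> Q k"
  proof
    assume "(\<Sum>a\<in>S. f k ^ (a k - \<mu>) * p a) \<in> Q k"
    then have "(\<Sum>a\<in>S. f k ^ (a k - \<mu>) * p a) \<in> Q (Suc k)"
      using sub step.hyps by blast
    also have "(\<Sum>a\<in>S. f k ^ (a k - \<mu>) * p a) =
        (\<Sum>a\<in>S-S'. f k ^ (a k - \<mu>) * p a) + (\<Sum>a\<in>S'. f k ^ (a k - \<mu>) * p a)"
      using step.prems by (intro sum.subset_diff) (auto simp: S'_def)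
    also have "(\<Sum>a\<in>S'. f k ^ (a k - \<mu>) * p a) = sum p S'"
      by (intro sum.cong) (auto simp: S'_def)
    finally have "(\<Sum>a\<in>S-S'. f k ^ (a k - \<mu>) * p a) + sum p S' \<in> Q (Suc k)" .
    moreover have "(\<Sum>a\<in>S-S'. f k ^ (a k - \<mu>) * p a) \<in> Q (Suc k)"
    proof (rule JSk(5))
      fix a assume "a \<in> S - S'"
      with \<mu>_le have "\<mu> < a k" by (fastforce simp: S'_def)
      then obtain e where "a k - \<mu> = Suc e" by (metis Suc_diff_Suc)
      then have "f k ^ (a k - \<mu>) * p a = (f k ^ e * p a) * f k" by (simp add: mult_ac)
      also have "\<dots> \<in> Q (Suc k)"
        using f step.hyps by (intro JSk(3)) auto
      finally show "f k ^ (a k - \<mu>) * p a \<in> Q (Suc k)" .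
    qed (use step.prems in auto)
    ultimately show False
      using JSk(4) notin by fastforce
  qed
  moreover have "f k ^ \<mu> \<notin> Q k"
    using primeideal_type_algebraD(3)[OF pk] f step.hyps by blast
  ultimately show ?case
    using primeideal_type_algebraD(2)[OF pk, of "f k ^ \<mu>"] by auto
qed

section \<open>Algebraic relations among more than n polynomials\<close>

lemma vector_space_mpoly:
  "vector_space (\<lambda>c f. Poly_Mapping.single 0 c * f :: ('n::{finite,linorder}, 'k::field) mpoly)"
  by unfold_locales
    (simp_all add: algebra_simps single_add mult_single flip: mult.assoc)

lemma mpoly_eq_sum_monomials:
  "f = (\<Sum>\<alpha>\<in>Poly_Mapping.keys f. Poly_Mapping.single \<alpha> (Poly_Mapping.lookup f \<alpha>))"
  by (rule poly_mapping_eqI)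
    (auto simp: lookup_sum lookup_single when_def in_keys_iff sum.delta)

lemma card_expo_le:
  "finite {\<alpha> :: 'n::{finite,linorder} expo. \<forall>i. Poly_Mapping.lookup \<alpha> i \<le> B}"
  "card {\<alpha> :: 'n::{finite,linorder} expo. \<forall>i. Poly_Mapping.lookup \<alpha> i \<le> B} \<le> Suc B ^ CARD('n)"
proof -
  let ?E = "{\<alpha> :: 'n expo. \<forall>i. Poly_Mapping.lookup \<alpha> i \<le> B}"
  have sub: "Poly_Mapping.lookup ` ?E \<subseteq> (\<Pi>\<^sub>E i\<in>UNIV. {..B})"
    by auto
  have inj: "inj_on Poly_Mapping.lookup ?E"
    by (auto intro: inj_onI poly_mapping_eqI)
  have fin: "finite (\<Pi>\<^sub>E i\<in>(UNIV::'n set). {..B})"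
    by (intro finite_PiE) auto
  show "finite ?E"
    using finite_subset[OF sub fin] inj by (rule finite_imageD)
  show "card ?E \<le> Suc B ^ CARD('n)"
    using card_inj_on_le[OF inj sub fin] by (simp add: card_PiE)
qed

text \<open>Exponents add under multiplication, so an exponent bound for f grows linearly with the
  power.\<close>

lemma keys_power_le:
  fixes f :: "('n::{finite,linorder}, 'k::field) mpoly"
  assumes "\<And>\<alpha> i. \<alpha> \<in> Poly_Mapping.keys f \<Longrightarrow> Poly_Mapping.lookup \<alpha> i \<le> d"
  shows "\<alpha> \<in> Poly_Mapping.keys (f ^ e) \<Longrightarrow> Poly_Mapping.lookup \<alpha> i \<le> e * d"
proof (induction e arbitrary: \<alpha>)
  case (Suc e)
  then obtain \<beta> \<gamma> where "\<alpha> = \<beta> + \<gamma>" "\<beta> \<in> Poly_Mapping.keys f" "\<gamma> \<in> Poly_Mapping.keys (f ^ e)"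
    using keys_mult[of f "f ^ e"] by auto
  then show ?case
    using Suc.IH assms by (simp add: lookup_add add_mono)
qed simp

lemma keys_prod_le:
  fixes f :: "'b \<Rightarrow> ('n::{finite,linorder}, 'k::field) mpoly"
  assumes "finite A" "\<And>a \<alpha>. a \<in> A \<Longrightarrow> \<alpha> \<in> Poly_Mapping.keys (f a) \<Longrightarrow> Poly_Mapping.lookup \<alpha> i \<le> d"
  shows "\<alpha> \<in> Poly_Mapping.keys (prod f A) \<Longrightarrow> Poly_Mapping.lookup \<alpha> i \<le> card A * d"
  using assms
proof (induction A arbitrary: \<alpha> rule: finite_induct)
  case (insert a A)
  then obtain \<beta> \<gamma> where "\<alpha> = \<beta> + \<gamma>" "\<beta> \<in> Poly_Mapping.keys (f a)" "\<gamma> \<in> Poly_Mapping.keys (prod f A)"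
    using keys_mult[of "f a" "prod f A"] by auto
  moreover have "Poly_Mapping.lookup \<gamma> i \<le> card A * d"
    using \<open>\<gamma> \<in> _\<close> insert.prems by (intro insert.IH) auto
  moreover have "Poly_Mapping.lookup \<beta> i \<le> d"
    using \<open>\<beta> \<in> _\<close> insert.prems by auto
  ultimately show ?case
    using insert.hyps by (simp add: lookup_add)
qed simp

text \<open>The family lies in the span of the monomials in a box of exponents, and an independent
  set is no larger than a finite spanning set. Independence refers to the indexed family, so it also
  yields injectivity of \<open>F\<close>.\<close>

lemma card_le_if_linearly_independent:
  fixes F :: "'b \<Rightarrow> ('n::{finite,linorder}, 'k::field) mpoly"
  assumes "finite A"
    and indep: "\<And>c. (\<Sum>a\<in>A. Poly_Mapping.single 0 (c a) * F a) = 0 \<Longrightarrow> \<forall>a\<in>A. c a = 0"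
    and bound: "\<And>a \<alpha> i. a \<in> A \<Longrightarrow> \<alpha> \<in> Poly_Mapping.keys (F a) \<Longrightarrow> Poly_Mapping.lookup \<alpha> i \<le> B"
  shows "card A \<le> Suc B ^ CARD('n)"
proof -
  interpret V: vector_space "\<lambda>c f. Poly_Mapping.single 0 c * f :: ('n, 'k) mpoly"
    by (rule vector_space_mpoly)
  let ?E = "{\<alpha> :: 'n expo. \<forall>i. Poly_Mapping.lookup \<alpha> i \<le> B}"
  let ?M = "(\<lambda>\<alpha>. Poly_Mapping.single \<alpha> (1::'k)) ` ?E"
  have inj: "inj_on F A"
  proof (rule inj_onI, rule ccontr)
    fix a b assume ab: "a \<in> A" "b \<in> A" "F a = F b" "a \<noteq> b"
    \<comment> \<open>Two equal members of the family would satisfy the relation with coefficients 1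
      and -1.\<close>
    define c where "c x = (if x = a then 1 else if x = b then -1 else 0 :: 'k)" for x
    have "(\<Sum>x\<in>A. Poly_Mapping.single 0 (c x) * F x) = (\<Sum>x\<in>{a,b}. Poly_Mapping.single 0 (c x) * F x)"
      using ab \<open>finite A\<close> by (intro sum.mono_neutral_right) (auto simp: c_def)
    also have "\<dots> = 0"
      using ab by (simp add: c_def single_uminus)
    finally have "c a = 0" using indep ab by blast
    then show False by (simp add: c_def)
  qed
  have "V.independent (F ` A)"
  proof (rule V.independent_if_scalars_zero)
    fix u x assume "(\<Sum>x\<in>F ` A. Poly_Mapping.single 0 (u x) * x) = 0" "x \<in> F ` A"
    then show "u x = 0"
      using indep[of "u \<circ> F"] by (auto simp: sum.reindex[OF inj])
  qed (use \<open>finite A\<close> in auto)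
  moreover have "F ` A \<subseteq> V.span ?M"
  proof
    fix f assume "f \<in> F ` A"
    then have *: "Poly_Mapping.keys f \<subseteq> ?E"
      using bound by auto
    have "(\<Sum>\<alpha>\<in>Poly_Mapping.keys f. Poly_Mapping.single 0 (Poly_Mapping.lookup f \<alpha>) * Poly_Mapping.single \<alpha> 1) \<in> V.span ?M"
      using * by (intro V.span_sum V.span_scale V.span_base) auto
    then show "f \<in> V.span ?M"
      by (subst mpoly_eq_sum_monomials) (simp add: mult_single)
  qed
  ultimately have "card (F ` A) \<le> card ?M"
    using V.independent_span_bound[of ?M "F ` A"] card_expo_le(1) by blast
  also have "\<dots> \<le> card ?E"
    by (intro card_image_le card_expo_le)
  finally show ?thesis
    using card_expo_le(2)[where 'n = 'n, of B] by (simp add: card_image inj)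
qed

text \<open>There are M^m power products with exponents below M, but their span has dimension at
  most (m * M * d + 1)^n, which grows more slowly in M because n < m. Restricting to extensional
  functions makes an exponent function depend on its values below m only.\<close>

lemma exists_algebraic_relation:
  fixes f :: "nat \<Rightarrow> ('n::{finite,linorder}, 'k::field) mpoly"
  assumes "CARD('n) < m"
  shows "\<exists>S c. finite S \<and> S \<noteq> {} \<and> S \<subseteq> extensional {..<m} \<and> (\<forall>a\<in>S. c a \<noteq> 0) \<and>
    (\<Sum>a\<in>S. Poly_Mapping.single 0 (c a) * (\<Prod>i<m. f i ^ a i)) = 0"
proof -
  let ?n = "CARD('n)"
  \<comment> \<open>A crude common bound for all exponents that occur in the f i.\<close>
  define d where "d = (\<Sum>i<m. \<Sum>\<alpha>\<in>Poly_Mapping.keys (f i). mdeg \<alpha>)"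
  have d: "Poly_Mapping.lookup \<alpha> j \<le> d" if "i < m" "\<alpha> \<in> Poly_Mapping.keys (f i)" for i j \<alpha>
  proof -
    have "Poly_Mapping.lookup \<alpha> j \<le> mdeg \<alpha>"
      unfolding mdeg_def by (rule member_le_sum) auto
    also have "\<dots> \<le> (\<Sum>\<alpha>\<in>Poly_Mapping.keys (f i). mdeg \<alpha>)"
      using that by (intro member_le_sum) auto
    also have "\<dots> \<le> d"
      unfolding d_def using that by (intro member_le_sum[where f = "\<lambda>i. sum mdeg (Poly_Mapping.keys (f i))"]) auto
    finally show ?thesis .
  qed
  \<comment> \<open>Large enough that (m * d + 1)^n < M, whence (m * M * d + 1)^n \<le> M^n * (m * d
    + 1)^n < M^(n+1) \<le> M^m.\<close>
  define M where "M = Suc (Suc (m * d) ^ ?n)"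
  define A where "A = (\<Pi>\<^sub>E i\<in>{..<m}. {..<M})"
  have "finite A" by (simp add: A_def finite_PiE)
  define F where "F a = (\<Prod>i<m. f i ^ a i)" for a
  have F_bound: "Poly_Mapping.lookup \<alpha> j \<le> m * (M * d)" if "a \<in> A" "\<alpha> \<in> Poly_Mapping.keys (F a)" for a \<alpha> j
  proof -
    have "Poly_Mapping.lookup \<alpha> j \<le> card {..<m} * (M * d)"
    proof (rule keys_prod_le[OF _ _ that(2)[unfolded F_def]])
      fix i \<beta> assume i: "i \<in> {..<m}" and "\<beta> \<in> Poly_Mapping.keys (f i ^ a i)"
      then have "Poly_Mapping.lookup \<beta> j \<le> a i * d"
        using keys_power_le[of "f i" d] d by auto
      also have "a i \<in> {..<M}"
        using i that by (auto simp: A_def)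
      then have "a i * d \<le> M * d" by simp
      finally show "Poly_Mapping.lookup \<beta> j \<le> M * d" .
    qed simp
    then show ?thesis by simp
  qed
  have "Suc (m * (M * d)) ^ ?n < card A"
  proof -
    have "Suc (m * (M * d)) ^ ?n \<le> (M * Suc (m * d)) ^ ?n"
      by (intro power_mono) (auto simp: M_def algebra_simps)
    also have "\<dots> = M ^ ?n * Suc (m * d) ^ ?n"
      by (rule power_mult_distrib)
    also have "\<dots> < M ^ ?n * M"
      by (intro mult_strict_left_mono) (simp_all add: M_def)
    also have "\<dots> = M ^ Suc ?n"
      by simp
    also have "\<dots> \<le> M ^ m"
      using assms by (intro power_increasing) (auto simp: M_def)
    also have "\<dots> = card A"
      by (simp add: A_def card_PiE)
    finally show ?thesis .
  qed
  have "\<exists>c. (\<Sum>a\<in>A. Poly_Mapping.single 0 (c a) * F a) = 0 \<and> \<not> (\<forall>a\<in>A. c a = 0)"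
  proof (rule ccontr)
    assume "\<nexists>c. (\<Sum>a\<in>A. Poly_Mapping.single 0 (c a) * F a) = 0 \<and> \<not> (\<forall>a\<in>A. c a = 0)"
    then have "\<forall>a\<in>A. c a = 0" if "(\<Sum>a\<in>A. Poly_Mapping.single 0 (c a) * F a) = 0" for c
      using that by blast
    then have "card A \<le> Suc (m * (M * d)) ^ ?n"
      by (rule card_le_if_linearly_independent[OF \<open>finite A\<close>, of F]) (auto dest: F_bound)
    with \<open>_ < card A\<close> show False by simp
  qed
  then obtain c a where c: "(\<Sum>a\<in>A. Poly_Mapping.single 0 (c a) * F a) = 0" "a \<in> A" "c a \<noteq> 0"
    by blast
  show ?thesis
  proof (intro exI[of _ "{a \<in> A. c a \<noteq> 0}"] exI[of _ c] conjI)
    show "{a \<in> A. c a \<noteq> 0} \<noteq> {}" using c by blast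
    show "{a \<in> A. c a \<noteq> 0} \<subseteq> extensional {..<m}" unfolding A_def PiE_def by blast
    have "(\<Sum>a\<in>{a \<in> A. c a \<noteq> 0}. Poly_Mapping.single 0 (c a) * F a) = (\<Sum>a\<in>A. Poly_Mapping.single 0 (c a) * F a)"
      using \<open>finite A\<close> by (intro sum.mono_neutral_left) auto
    with c show "(\<Sum>a\<in>{a \<in> A. c a \<noteq> 0}. Poly_Mapping.single 0 (c a) * (\<Prod>i<m. f i ^ a i)) = 0"
      by (simp add: F_def)
    show "finite {a \<in> A. c a \<noteq> 0}" using \<open>finite A\<close> by simp
    show "\<forall>a\<in>{a \<in> A. c a \<noteq> 0}. c a \<noteq> 0" by blast
  qed
qed

text \<open>Elements chosen from the strict steps of the chain admit no relation with constant
  coefficients, which contradicts the dimension count once m > n.\<close>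

lemma prime_chain_length_le:
  fixes Q :: "nat \<Rightarrow> ('n::{finite,linorder}, 'k::field) mpoly set"
  assumes prime: "\<And>i. i \<le> m \<Longrightarrow> primeideal (Q i) poly_ring"
    and sub: "\<And>i. i < m \<Longrightarrow> Q i \<subset> Q (Suc i)"
  shows "m \<le> CARD('n)"
proof (rule ccontr)
  assume "\<not> m \<le> CARD('n)"
  then have "CARD('n) < m" by simp
  have "\<exists>f. f \<in> Q (Suc i) \<and> f \<notin> Q i" if "i < m" for i
    using sub[OF that] by blast
  then obtain f where f: "\<And>i. i < m \<Longrightarrow> f i \<in> Q (Suc i)" "\<And>i. i < m \<Longrightarrow> f i \<notin> Q i"
    by metis
  obtain S c where S: "finite S" "S \<noteq> {}" "S \<subseteq> extensional {..<m}" "\<forall>a\<in>S. c a \<noteq> 0"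
    "(\<Sum>a\<in>S. Poly_Mapping.single 0 (c a) * (\<Prod>i<m. f i ^ a i)) = 0"
    using exists_algebraic_relation[OF \<open>CARD('n) < m\<close>, of f] by (elim exE conjE)
  have "(\<Sum>a\<in>S. Poly_Mapping.single 0 (c a) * (\<Prod>i\<in>{0..<m}. f i ^ a i)) \<notin> Q 0"
  proof (rule prime_chain_monomials_notin[where m = m])
    show "a = b" if "a \<in> S" "b \<in> S" "\<And>i. 0 \<le> i \<Longrightarrow> i < m \<Longrightarrow> a i = b i" for a b
      using that S(3) by (intro extensionalityI[of a "{..<m}" b]) auto
    \<comment> \<open>A nonzero constant is a unit and hence lies in no prime ideal.\<close>
    show "Poly_Mapping.single 0 (c a) \<notin> Q m" if "a \<in> S" for a
    proof
      assume "Poly_Mapping.single 0 (c a) \<in> Q m"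
      then have "Poly_Mapping.single 0 (inverse (c a)) * Poly_Mapping.single 0 (c a) \<in> Q m"
        by (rule ideal_type_algebraD(3)[OF primeideal.axioms(1)[OF prime[OF order_refl]]])
      then show False
        using bspec[OF S(4) that] primeideal_type_algebraD(1)[OF prime[OF order_refl]] by (simp add: mult_single)
    qed
    show "Q i \<subseteq> Q (Suc i)" if "i < m" for i
      using sub[OF that] by (rule psubset_imp_subset)
  qed (use S(1,2) f prime in simp_all)
  then show False
    using S(5) ideal_type_algebraD(1)[OF primeideal.axioms(1)[OF prime]] by (simp add: atLeast0LessThan)
qed

section \<open>Cosets, and lifting chains of primes from the quotient\<close>

lemma coset_type_algebra:
  "J +>\<^bsub>ring_of_type_algebra\<^esub> f = (\<lambda>x. x + f) ` J"
  by (auto simp: a_r_coset_def r_coset_def)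

lemma coset_eq_iff:
  fixes J :: "'a::comm_ring_1 set"
  assumes "ideal J ring_of_type_algebra"
  shows "J +>\<^bsub>ring_of_type_algebra\<^esub> f = J +>\<^bsub>ring_of_type_algebra\<^esub> g \<longleftrightarrow> f - g \<in> J"
proof
  assume "J +>\<^bsub>ring_of_type_algebra\<^esub> f = J +>\<^bsub>ring_of_type_algebra\<^esub> g"
  moreover have "f \<in> J +>\<^bsub>ring_of_type_algebra\<^esub> f"
    using ideal_type_algebraD(1)[OF assms] by (force simp: coset_type_algebra)
  ultimately show "f - g \<in> J"
    by (auto simp: coset_type_algebra)
next
  assume fg: "f - g \<in> J"
  have "x + f \<in> (\<lambda>x. x + g) ` J" if "x \<in> J" for x
    using ideal_type_algebraD(2)[OF assms that fg] by (auto intro!: image_eqI[of _ _ "x + (f - g)"])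
  moreover have "x + g \<in> (\<lambda>x. x + f) ` J" if "x \<in> J" for x
    using ideal_type_algebraD(4)[OF assms that fg] by (auto intro!: image_eqI[of _ _ "x - (f - g)"])
  ultimately show "J +>\<^bsub>ring_of_type_algebra\<^esub> f = J +>\<^bsub>ring_of_type_algebra\<^esub> g"
    by (auto simp: coset_type_algebra)
qed

lemma carrier_quot:
  "carrier (ring_of_type_algebra Quot J) = range (\<lambda>f. J +>\<^bsub>ring_of_type_algebra\<^esub> f)"
  by (auto simp: FactRing_def A_RCOSETS_def')

text \<open>Makes the zero ideal prime, so that it can start a chain.\<close>

lemma domain_type_algebra: "domain (ring_of_type_algebra :: 'a::idom ring)"
  by (intro domain.intro domain_axioms.intro cring_from_type_algebra) auto

text \<open>If D were at least n, the quotient would have a prime chain with at least n strict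
  inclusions. Its preimages contain the nonzero ideal \<open>I\<close>, so putting the zero ideal
  below them gives more than n inclusions.\<close>

lemma ideal_dim_less:
  fixes I :: "('n::{finite,linorder}, 'k::field) mpoly set"
  assumes I: "ideal I poly_ring" and "I \<noteq> {0}" and "ideal_dim I = enat D"
  shows "D < CARD('n)"
proof (rule ccontr)
  assume "\<not> D < CARD('n)"
  \<comment> \<open>A strict bound below the supremum is exceeded by the length of an actual
    chain.\<close>
  then have "enat (CARD('n) - 1) < ideal_dim I"
    using assms(3) zero_less_card_finite[where 'a = 'n] by (simp del: zero_less_card_finite)
  then have "\<exists>d p. CARD('n) - 1 < d \<and> (\<forall>i\<le>d. primeideal (p i) (poly_ring Quot I)) \<and> (\<forall>i<d. p i \<subset> p (Suc i))"
    unfolding ideal_dim_def krull_dim_def less_Sup_iff by (elim bexE CollectE exE conjE) (metis enat_ord_simps(2))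
  then obtain d p where d: "CARD('n) - 1 < d"
    and p: "\<And>i. i \<le> d \<Longrightarrow> primeideal (p i) (poly_ring Quot I)" "\<And>i. i < d \<Longrightarrow> p i \<subset> p (Suc i)"
    by blast
  let ?\<pi> = "\<lambda>f. I +>\<^bsub>poly_ring\<^esub> f"
  interpret I: ideal I poly_ring by fact
  have cring: "cring (poly_ring :: ('n, 'k) mpoly ring)" ..
  \<comment> \<open>Position 0 holds the zero ideal; the preimages of the p j are shifted up by
    one.\<close>
  define Q where "Q i = (case i of 0 \<Rightarrow> {0} | Suc j \<Rightarrow> {f. ?\<pi> f \<in> p j})" for i
  have "Suc d \<le> CARD('n)"
  proof (rule prime_chain_length_le)
    fix i assume "i \<le> Suc d"
    show "primeideal (Q i) poly_ring"
    proof (cases i)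
      case 0
      show ?thesis
        using domain.zeroprimeideal[OF domain_type_algebra] by (simp add: Q_def 0)
    next
      case (Suc j)
      then show ?thesis
        using ring_hom_ring.primeideal_vimage[OF I.rcos_ring_hom_ring cring p(1), of j] \<open>i \<le> Suc d\<close>
        by (simp add: Q_def)
    qed
  next
    fix i assume "i < Suc d"
    show "Q i \<subset> Q (Suc i)"
    proof (cases i)
      case 0
      obtain f where f: "f \<in> I" "f \<noteq> 0"
        using ideal_type_algebraD(1)[OF I] \<open>I \<noteq> {0}\<close> by auto
      interpret p: ideal "p 0" "poly_ring Quot I"
        using p(1)[of 0] by (simp add: primeideal.axioms)
      have "I \<in> p 0"
        using additive_subgroup.zero_closed[OF p.additive_subgroup_axioms] by (simp add: FactRing_def)
      moreover have "?\<pi> x = I" if "x \<in> I" for x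
        using coset_eq_iff[OF I, of x 0] that by (simp add: coset_type_algebra)
      ultimately have "I \<subseteq> Q (Suc 0)"
        by (auto simp: Q_def)
      then show ?thesis
        using f ideal_type_algebraD(1)[OF I] by (auto simp: 0 Q_def)
    next
      case (Suc j)
      then have j: "j < d" using \<open>i < Suc d\<close> by simp
      interpret p: ideal "p (Suc j)" "poly_ring Quot I"
        using p(1)[of "Suc j"] j by (simp add: primeideal.axioms)
      \<comment> \<open>Every coset has a representative, so a coset that separates two primes lifts
        to a polynomial that separates their preimages.\<close>
      obtain x where x: "x \<in> p (Suc j)" "x \<notin> p j"
        using p(2)[OF j] by blast
      then obtain f where "x = ?\<pi> f"
        using p.a_subset carrier_quot[of I] by auto
      with x p(2)[OF j] show ?thesis
        by (auto simp: Suc Q_def)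
    qed
  qed
  with d show False by simp
qed


section \<open>Leading terms and standard monomials\<close>

lemma mdeg_add [simp]: "mdeg (\<alpha> + \<beta>) = mdeg \<alpha> + mdeg \<beta>"
  by (simp add: mdeg_def lookup_add sum.distrib)

lemma degrevlex_irrefl: "\<not> \<alpha> \<prec>drl \<alpha>"
  by (simp add: degrevlex_def)

lemma degrevlex_add: "\<alpha> \<prec>drl \<beta> \<Longrightarrow> \<gamma> + \<alpha> \<prec>drl \<gamma> + \<beta>"
  by (simp add: degrevlex_def lookup_add)

text \<open>In equal degree the largest index at which the exponents differ decides; it exists
  because there are finitely many variables.\<close>

lemma degrevlex_total:
  assumes "\<alpha> \<noteq> \<beta>"
  shows "\<alpha> \<prec>drl \<beta> \<or> \<beta> \<prec>drl \<alpha>"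
proof -
  define i where "i = Max {i. Poly_Mapping.lookup \<alpha> i \<noteq> Poly_Mapping.lookup \<beta> i}"
  have "{i. Poly_Mapping.lookup \<alpha> i \<noteq> Poly_Mapping.lookup \<beta> i} \<noteq> {}"
    using assms by (auto intro: poly_mapping_eqI)
  then have "Poly_Mapping.lookup \<alpha> i \<noteq> Poly_Mapping.lookup \<beta> i"
    using Max_in[of "{i. Poly_Mapping.lookup \<alpha> i \<noteq> Poly_Mapping.lookup \<beta> i}"] by (simp add: i_def)
  moreover have "Poly_Mapping.lookup \<alpha> j = Poly_Mapping.lookup \<beta> j" if "i < j" for j
    using that Max_ge[of "{i. Poly_Mapping.lookup \<alpha> i \<noteq> Poly_Mapping.lookup \<beta> i}" j]
    by (auto simp: i_def not_le[symmetric])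
  ultimately show ?thesis
    unfolding degrevlex_def using nat_neq_iff by metis
qed

lemma degrevlex_trans:
  assumes "\<alpha> \<prec>drl \<beta>" "\<beta> \<prec>drl \<gamma>"
  shows "\<alpha> \<prec>drl \<gamma>"
proof (cases "mdeg \<alpha> = mdeg \<beta> \<and> mdeg \<beta> = mdeg \<gamma>")
  case True
  then obtain i j
    where i: "Poly_Mapping.lookup \<beta> i < Poly_Mapping.lookup \<alpha> i" "\<forall>l>i. Poly_Mapping.lookup \<alpha> l = Poly_Mapping.lookup \<beta> l"
      and j: "Poly_Mapping.lookup \<gamma> j < Poly_Mapping.lookup \<beta> j" "\<forall>l>j. Poly_Mapping.lookup \<beta> l = Poly_Mapping.lookup \<gamma> l"
    using assms by (auto simp: degrevlex_def)
  \<comment> \<open>The larger of the two deciding indices decides the composite comparison: one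
    comparison is strict there and the other is strict or an equality.\<close>
  have "Poly_Mapping.lookup \<gamma> (max i j) < Poly_Mapping.lookup \<alpha> (max i j)"
    using i j by (cases i j rule: linorder_cases) (auto simp: max_def)
  moreover have "\<forall>l>max i j. Poly_Mapping.lookup \<alpha> l = Poly_Mapping.lookup \<gamma> l"
    using i j by simp
  ultimately show ?thesis
    using True unfolding degrevlex_def by auto
next
  case False
  with assms show ?thesis by (auto simp: degrevlex_def)
qed

text \<open>\<open>LT\<close> is a definite description; irreflexivity and transitivity make a
  greatest monomial unique.\<close>

lemma LT_eqI:
  assumes "\<alpha> \<in> Poly_Mapping.keys f" "\<And>\<beta>. \<beta> \<in> Poly_Mapping.keys f \<Longrightarrow> \<beta> \<noteq> \<alpha> \<Longrightarrow> \<beta> \<prec>drl \<alpha>"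
  shows "LT f = \<alpha>"
  unfolding LT_def
proof (rule the_equality)
  fix \<beta> assume \<beta>: "\<beta> \<in> Poly_Mapping.keys f \<and> (\<forall>\<gamma>\<in>Poly_Mapping.keys f. \<gamma> \<noteq> \<beta> \<longrightarrow> \<gamma> \<prec>drl \<beta>)"
  show "\<beta> = \<alpha>"
  proof (rule ccontr)
    assume "\<beta> \<noteq> \<alpha>"
    then have "\<alpha> \<prec>drl \<beta>" "\<beta> \<prec>drl \<alpha>"
      using assms \<beta> by auto
    then show False
      using degrevlex_trans degrevlex_irrefl by blast
  qed
qed (use assms in auto)

text \<open>A finite nonempty set has a greatest element in a total transitive order, so the
  description \<open>LT\<close> is proper for every nonzero polynomial.\<close>

lemma
  assumes "f \<noteq> 0"
  shows LT_in_keys: "LT f \<in> Poly_Mapping.keys f"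
    and keys_less_LT: "\<beta> \<in> Poly_Mapping.keys f \<Longrightarrow> \<beta> \<noteq> LT f \<Longrightarrow> \<beta> \<prec>drl LT f"
proof -
  have "\<exists>\<alpha>\<in>A. \<forall>\<beta>\<in>A. \<beta> \<noteq> \<alpha> \<longrightarrow> \<beta> \<prec>drl \<alpha>" if "finite A" "A \<noteq> {}" for A :: "'a expo set"
    using that
  proof (induction A rule: finite_ne_induct)
    case (insert \<gamma> A)
    then obtain \<alpha> where "\<alpha> \<in> A" "\<forall>\<beta>\<in>A. \<beta> \<noteq> \<alpha> \<longrightarrow> \<beta> \<prec>drl \<alpha>" by blast
    with degrevlex_total[of \<gamma> \<alpha>] show ?case
      by (metis degrevlex_trans insert_iff)
  qed simp
  from this[of "Poly_Mapping.keys f"] obtain \<alpha>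
    where \<alpha>: "\<alpha> \<in> Poly_Mapping.keys f" "\<And>\<beta>. \<beta> \<in> Poly_Mapping.keys f \<Longrightarrow> \<beta> \<noteq> \<alpha> \<Longrightarrow> \<beta> \<prec>drl \<alpha>"
    using assms by auto
  then have "LT f = \<alpha>" by (rule LT_eqI)
  with \<alpha> show "LT f \<in> Poly_Mapping.keys f" "\<beta> \<in> Poly_Mapping.keys f \<Longrightarrow> \<beta> \<noteq> LT f \<Longrightarrow> \<beta> \<prec>drl LT f"
    by auto
qed

text \<open>Translation of exponents is injective, so no terms cancel and the support is determined
  exactly.\<close>

lemma keys_single_mult:
  fixes f :: "('n::{finite,linorder}, 'k::field) mpoly"
  assumes "c \<noteq> 0"
  shows "Poly_Mapping.keys (Poly_Mapping.single \<gamma> c * f) = (+) \<gamma> ` Poly_Mapping.keys f"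
proof -
  have *: "Poly_Mapping.lookup (Poly_Mapping.single \<gamma> c * f) \<beta> =
      (\<Sum>\<alpha>\<in>Poly_Mapping.keys f. c * Poly_Mapping.lookup f \<alpha> when \<gamma> + \<alpha> = \<beta>)" for \<beta>
    by (subst mpoly_eq_sum_monomials[of f]) (simp add: sum_distrib_left mult_single lookup_sum lookup_single)
  have "Poly_Mapping.lookup (Poly_Mapping.single \<gamma> c * f) (\<gamma> + \<delta>) = c * Poly_Mapping.lookup f \<delta>" for \<delta>
    unfolding * by (cases "\<delta> \<in> Poly_Mapping.keys f") (auto simp: when_def sum.delta in_keys_iff)
  moreover have "Poly_Mapping.lookup (Poly_Mapping.single \<gamma> c * f) \<beta> = 0"
    if "\<beta> \<notin> (+) \<gamma> ` Poly_Mapping.keys f" for \<beta>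
    unfolding * using that by (intro sum.neutral) auto
  ultimately show ?thesis
    using assms by (force simp: in_keys_iff simp del: not_in_keys_iff_lookup_eq_zero)
qed

lemma LT_single_mult:
  fixes f :: "('n::{finite,linorder}, 'k::field) mpoly"
  assumes "f \<noteq> 0"
  shows "LT (Poly_Mapping.single \<gamma> 1 * f) = \<gamma> + LT f"
proof (rule LT_eqI)
  show "\<gamma> + LT f \<in> Poly_Mapping.keys (Poly_Mapping.single \<gamma> 1 * f)"
    using LT_in_keys[OF assms] by (simp add: keys_single_mult)
  show "\<beta> \<prec>drl \<gamma> + LT f" if "\<beta> \<in> Poly_Mapping.keys (Poly_Mapping.single \<gamma> 1 * f)" "\<beta> \<noteq> \<gamma> + LT f" for \<beta>
    using that keys_less_LT[OF assms] by (auto simp: keys_single_mult degrevlex_add)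
qed

section \<open>Leading exponents and the leading ideal\<close>

definition LTs :: "('n::{finite,linorder}, 'k::field) mpoly set \<Rightarrow> 'n expo set"
  where "LTs I = LT ` (I - {0})"

lemma add_in_LTs:
  fixes I :: "('n::{finite,linorder}, 'k::field) mpoly set"
  assumes I: "ideal I poly_ring" and "\<alpha> \<in> LTs I"
  shows "\<gamma> + \<alpha> \<in> LTs I"
proof -
  obtain f where f: "f \<in> I" "f \<noteq> 0" "\<alpha> = LT f"
    using assms by (auto simp: LTs_def)
  have "Poly_Mapping.single \<gamma> 1 * f \<in> I"
    using ideal_type_algebraD(3)[OF I] f by blast
  moreover have "Poly_Mapping.single \<gamma> (1::'k) \<noteq> 0"
    by (metis keys_single keys_zero insert_not_empty zero_neq_one)
  ultimately show ?thesis
    using f LT_single_mult[of f \<gamma>] by (force simp: LTs_def)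
qed

text \<open>Nothing lies below the exponent 0, so a polynomial with this leading exponent is a
  nonzero constant, and a proper ideal contains no unit.\<close>

lemma zero_notin_LTs:
  fixes I :: "('n::{finite,linorder}, 'k::field) mpoly set"
  assumes I: "ideal I poly_ring" and "I \<noteq> UNIV"
  shows "0 \<notin> LTs I"
proof
  assume "0 \<in> LTs I"
  then obtain f where "0 = LT f" "f \<in> I - {0}"
    unfolding LTs_def by (rule imageE)
  then have f: "f \<in> I" "f \<noteq> 0" "LT f = 0"
    by auto
  have "\<not> \<beta> \<prec>drl 0" for \<beta> :: "'n expo"
    by (auto simp: degrevlex_def mdeg_def)
  then have keys: "Poly_Mapping.keys f = {0}"
    using LT_in_keys[OF f(2)] keys_less_LT[OF f(2)] f(3) by auto
  then have "f = Poly_Mapping.single 0 (Poly_Mapping.lookup f 0)"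
    using mpoly_eq_sum_monomials[of f] by simp
  moreover have "Poly_Mapping.lookup f 0 \<noteq> 0"
    using keys by (metis in_keys_iff singletonI)
  ultimately have "1 = Poly_Mapping.single 0 (inverse (Poly_Mapping.lookup f 0)) * f"
    by (metis mult_single add_0 left_inverse single_one)
  then have "1 \<in> I"
    using ideal_type_algebraD(3)[OF I f(1)] by metis
  then have "g \<in> I" for g
    using ideal_type_algebraD(3)[OF I, of 1 g] by simp
  with \<open>I \<noteq> UNIV\<close> show False by blast
qed

text \<open>\<open>LTs I\<close> is closed under translation, so the polynomials supported on it
  form an ideal containing the generators. Conversely, each of them is a combination of generators.
  Membership thus becomes a condition on supports.\<close>

lemma leading_ideal_eq:
  fixes I :: "('n::{finite,linorder}, 'k::field) mpoly set"
  assumes I: "ideal I poly_ring"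
  shows "leading_ideal I = {g. Poly_Mapping.keys g \<subseteq> LTs I}"
proof
  interpret R: ring "poly_ring :: ('n, 'k) mpoly ring" ..
  let ?S = "{Poly_Mapping.single (LT f) (1::'k) | f. f \<in> I \<and> f \<noteq> 0}"
  have "ideal {g :: ('n, 'k) mpoly. Poly_Mapping.keys g \<subseteq> LTs I} poly_ring"
  proof (rule idealI)
    show "subgroup {g :: ('n, 'k) mpoly. Poly_Mapping.keys g \<subseteq> LTs I} (add_monoid poly_ring)"
    proof
      fix x assume "x \<in> {g :: ('n, 'k) mpoly. Poly_Mapping.keys g \<subseteq> LTs I}"
      moreover have "inv\<^bsub>add_monoid poly_ring\<^esub> x = - x"
        unfolding a_inv_def[symmetric] by (rule R.minus_equality) auto
      ultimately show "inv\<^bsub>add_monoid poly_ring\<^esub> x \<in> {g. Poly_Mapping.keys g \<subseteq> LTs I}"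
        by (simp add: subset_iff in_keys_iff)
    next
      fix x y assume "x \<in> {g :: ('n, 'k) mpoly. Poly_Mapping.keys g \<subseteq> LTs I}"
        "y \<in> {g :: ('n, 'k) mpoly. Poly_Mapping.keys g \<subseteq> LTs I}"
      then show "x \<otimes>\<^bsub>add_monoid poly_ring\<^esub> y \<in> {g. Poly_Mapping.keys g \<subseteq> LTs I}"
        using Poly_Mapping.keys_add[of x y] by auto
    qed auto
    fix g x assume g: "g \<in> {g :: ('n, 'k) mpoly. Poly_Mapping.keys g \<subseteq> LTs I}"
    have "Poly_Mapping.keys (x * g) \<subseteq> LTs I"
      using g add_in_LTs[OF I] keys_mult[of x g] by blast
    then show "x \<otimes>\<^bsub>poly_ring\<^esub> g \<in> {g. Poly_Mapping.keys g \<subseteq> LTs I}"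
      and "g \<otimes>\<^bsub>poly_ring\<^esub> x \<in> {g. Poly_Mapping.keys g \<subseteq> LTs I}"
      by (simp_all add: mult.commute)
  qed (rule R.ring_axioms)
  then show "leading_ideal I \<subseteq> {g. Poly_Mapping.keys g \<subseteq> LTs I}"
    unfolding leading_ideal_def by (rule R.genideal_minimal) (auto simp: LTs_def)
  have L: "ideal (leading_ideal I) poly_ring"
    unfolding leading_ideal_def by (rule R.genideal_ideal) simp
  have S: "?S \<subseteq> leading_ideal I"
    unfolding leading_ideal_def by (rule R.genideal_self) simp
  show "{g. Poly_Mapping.keys g \<subseteq> LTs I} \<subseteq> leading_ideal I"
  proof
    fix g :: "('n, 'k) mpoly" assume "g \<in> {g. Poly_Mapping.keys g \<subseteq> LTs I}"
    then have "Poly_Mapping.single \<alpha> (Poly_Mapping.lookup g \<alpha>) \<in> leading_ideal I"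
      if "\<alpha> \<in> Poly_Mapping.keys g" for \<alpha>
    proof -
      have "Poly_Mapping.single \<alpha> 1 \<in> leading_ideal I"
        using that \<open>g \<in> _\<close> S by (fastforce simp: LTs_def)
      from ideal_type_algebraD(3)[OF L this, of "Poly_Mapping.single 0 (Poly_Mapping.lookup g \<alpha>)"]
      show ?thesis by (simp add: mult_single)
    qed
    then show "g \<in> leading_ideal I"
      by (subst mpoly_eq_sum_monomials) (intro ideal_type_algebraD(5)[OF L], auto)
  qed
qed

section \<open>Cones of exponents and the direct sum of a Pommaret basis\<close>

definition cone :: "'n::{finite,linorder} expo \<Rightarrow> 'n set \<Rightarrow> 'n expo set"
  where "cone \<alpha> U = {\<alpha> + \<gamma> | \<gamma>. Poly_Mapping.keys \<gamma> \<subseteq> U}"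

text \<open>Exhibits the summands in \<open>pommaret_basis\<close> as spans of monomials.\<close>

lemma polys_in_times_single:
  fixes \<alpha> :: "'n::{finite,linorder} expo"
  shows "{g * Poly_Mapping.single \<alpha> 1 | g. g \<in> polys_in U} =
    {f :: ('n, 'k::field) mpoly. Poly_Mapping.keys f \<subseteq> cone \<alpha> U}"
proof (intro equalityI subsetI)
  fix f :: "('n, 'k) mpoly" assume "f \<in> {g * Poly_Mapping.single \<alpha> 1 | g. g \<in> polys_in U}"
  then obtain g where "f = Poly_Mapping.single \<alpha> 1 * g" "g \<in> polys_in U"
    by (auto simp: mult.commute)
  then show "f \<in> {f. Poly_Mapping.keys f \<subseteq> cone \<alpha> U}"
    by (auto simp: keys_single_mult polys_in_def cone_def)
next
  fix f :: "('n, 'k) mpoly" assume f: "f \<in> {f. Poly_Mapping.keys f \<subseteq> cone \<alpha> U}"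
  \<comment> \<open>The quotient of f by the monomial; truncated subtraction is exact because every
    exponent of f lies in the cone.\<close>
  define g where "g = (\<Sum>\<beta>\<in>Poly_Mapping.keys f. Poly_Mapping.single (\<beta> - \<alpha>) (Poly_Mapping.lookup f \<beta>))"
  have *: "\<beta> - \<alpha> + \<alpha> = \<beta>" "Poly_Mapping.keys (\<beta> - \<alpha>) \<subseteq> U" if "\<beta> \<in> Poly_Mapping.keys f" for \<beta>
  proof -
    obtain \<gamma> where "\<beta> = \<alpha> + \<gamma>" "Poly_Mapping.keys \<gamma> \<subseteq> U"
      using f \<open>\<beta> \<in> _\<close> by (auto simp: cone_def)
    then show "\<beta> - \<alpha> + \<alpha> = \<beta>" "Poly_Mapping.keys (\<beta> - \<alpha>) \<subseteq> U"
      by (simp_all add: add.commute)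
  qed
  have "g * Poly_Mapping.single \<alpha> 1 = f"
    by (subst (3) mpoly_eq_sum_monomials) (simp add: g_def sum_distrib_right mult_single *)
  moreover have "g \<in> polys_in U"
  proof -
    have "Poly_Mapping.keys g \<subseteq> (\<Union>\<beta>\<in>Poly_Mapping.keys f. {\<beta> - \<alpha>})"
      unfolding g_def by (rule order_trans[OF Poly_Mapping.keys_sum]) auto
    with *(2) show ?thesis unfolding polys_in_def by blast
  qed
  ultimately show "f \<in> {g * Poly_Mapping.single \<alpha> 1 | g. g \<in> polys_in U}"
    by blast
qed

text \<open>It suffices to test the decomposition on monomials. A monomial in two of the sets would
  have two decompositions, and a monomial of the whole space must occur in the support of some
  summand.\<close>

lemma direct_sum_monomial_spans:
  fixes C :: "'h \<Rightarrow> 'n::{finite,linorder} expo set"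
  assumes "finite H"
    and "is_direct_sum H (\<lambda>h. {f. Poly_Mapping.keys f \<subseteq> C h})
      {f :: ('n, 'k::field) mpoly. Poly_Mapping.keys f \<subseteq> L}"
  shows "disjoint_family_on C H" and "(\<Union>h\<in>H. C h) = L"
proof -
  let ?V = "\<Pi>\<^sub>E h\<in>H. {f :: ('n, 'k) mpoly. Poly_Mapping.keys f \<subseteq> C h}"
  \<comment> \<open>The decomposition of a monomial with h as its only nonzero component, restricted
    to \<open>H\<close> as \<open>PiE\<close> demands.\<close>
  define e :: "'n expo \<Rightarrow> 'h \<Rightarrow> 'h \<Rightarrow> ('n, 'k) mpoly"
    where "e \<alpha> h = (\<lambda>h'\<in>H. if h' = h then Poly_Mapping.single \<alpha> 1 else 0)" for \<alpha> h
  have inj: "inj_on (\<lambda>v. \<Sum>h\<in>H. v h) ?V"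
    and image: "(\<lambda>v. \<Sum>h\<in>H. v h) ` ?V = {f. Poly_Mapping.keys f \<subseteq> L}"
    using assms(2) by (simp_all add: is_direct_sum_def bij_betw_def)
  have e: "e \<alpha> h \<in> ?V" "(\<Sum>h'\<in>H. e \<alpha> h h') = Poly_Mapping.single \<alpha> 1"
    if "h \<in> H" "\<alpha> \<in> C h" for h \<alpha>
    using that \<open>finite H\<close> by (auto simp: e_def sum.delta)
  show "disjoint_family_on C H"
    unfolding disjoint_family_on_def
  proof (intro ballI impI, rule ccontr)
    fix h h' assume h: "h \<in> H" "h' \<in> H" "h \<noteq> h'" "C h \<inter> C h' \<noteq> {}"
    then obtain \<alpha> where \<alpha>: "\<alpha> \<in> C h" "\<alpha> \<in> C h'" by blast
    have "e \<alpha> h = e \<alpha> h'"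
      by (rule inj_onD[OF inj]) (use e h \<alpha> in simp_all)
    then have "e \<alpha> h h = e \<alpha> h' h" by simp
    then have "Poly_Mapping.single \<alpha> (1::'k) = 0"
      using h by (simp add: e_def)
    then show False
      by (metis keys_single keys_zero insert_not_empty zero_neq_one)
  qed
  show "(\<Union>h\<in>H. C h) = L"
  proof (intro equalityI subsetI)
    fix \<alpha> assume "\<alpha> \<in> (\<Union>h\<in>H. C h)"
    then obtain h where h: "h \<in> H" "\<alpha> \<in> C h" by blast
    have "Poly_Mapping.single \<alpha> (1::'k) \<in> {f. Poly_Mapping.keys f \<subseteq> L}"
      unfolding image[symmetric] using e[OF h] by (intro image_eqI[of _ _ "e \<alpha> h"]) simp_all
    then show "\<alpha> \<in> L" by simp
  next
    fix \<alpha> assume "\<alpha> \<in> L"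
    then have "Poly_Mapping.single \<alpha> (1::'k) \<in> (\<lambda>v. \<Sum>h\<in>H. v h) ` ?V"
      unfolding image by simp
    then obtain v where v: "v \<in> ?V" "Poly_Mapping.single \<alpha> (1::'k) = (\<Sum>h\<in>H. v h)"
      by blast
    have "\<alpha> \<in> Poly_Mapping.keys (\<Sum>h\<in>H. v h)"
      by (simp flip: v(2))
    then obtain h where "h \<in> H" "\<alpha> \<in> Poly_Mapping.keys (v h)"
      using Poly_Mapping.keys_sum[of v H] by blast
    with v(1) show "\<alpha> \<in> (\<Union>h\<in>H. C h)"
      by (auto simp: PiE_iff)
  qed
qed

lemma pommaret_basis_cones:
  fixes I H :: "('n::{finite,linorder}, 'k::field) mpoly set"
  assumes "ideal I poly_ring" "pommaret_basis H I"
  shows "disjoint_family_on (\<lambda>h. cone (LT h) (mult_vars h)) H"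
    and "(\<Union>h\<in>H. cone (LT h) (mult_vars h)) = LTs I"
  using direct_sum_monomial_spans[of H "\<lambda>h. cone (LT h) (mult_vars h)" "LTs I", where 'k = 'k] assms
  unfolding pommaret_basis_def polys_in_times_single leading_ideal_eq[OF assms(1)] by blast+

section \<open>Standard monomials as a basis of each graded component of the quotient\<close>

lemma keys_hom_comp: "Poly_Mapping.keys (hom_comp s f) = {\<alpha> \<in> Poly_Mapping.keys f. mdeg \<alpha> = s}"
proof -
  have "Poly_Mapping.lookup (hom_comp s f) \<alpha> = (if mdeg \<alpha> = s then Poly_Mapping.lookup f \<alpha> else 0)" for \<alpha>
    by (auto simp: hom_comp_def lookup_sum lookup_single when_def sum.delta in_keys_iff)
  then show ?thesis
    by (auto simp: in_keys_iff simp del: not_in_keys_iff_lookup_eq_zero split: if_splits)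
qed

lemma finite_mdeg_eq: "finite {\<alpha> :: 'n::{finite,linorder} expo. mdeg \<alpha> = s}"
proof (rule finite_subset[OF _ card_expo_le(1)])
  show "{\<alpha> :: 'n expo. mdeg \<alpha> = s} \<subseteq> {\<alpha>. \<forall>i. Poly_Mapping.lookup \<alpha> i \<le> s}"
    unfolding mdeg_def by (auto intro!: member_le_sum[where f = "Poly_Mapping.lookup _"])
qed

definition std_monomials :: "('n::{finite,linorder}, 'k::field) mpoly set \<Rightarrow> nat \<Rightarrow> 'n expo set"
  where "std_monomials I s = {\<alpha>. mdeg \<alpha> = s} - LTs I"

text \<open>The leading exponent of a nonzero g would be standard and a leading exponent of
  \<open>I\<close> at once.\<close>

lemma std_monomials_independent:
  fixes I :: "('n::{finite,linorder}, 'k::field) mpoly set"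
  assumes "g \<in> I" "Poly_Mapping.keys g \<subseteq> std_monomials I s"
  shows "g = 0"
proof (rule ccontr)
  assume "g \<noteq> 0"
  then have "LT g \<in> LTs I" "LT g \<in> std_monomials I s"
    using assms LT_in_keys[OF \<open>g \<noteq> 0\<close>] by (auto simp: LTs_def)
  then show False by (simp add: std_monomials_def)
qed

text \<open>Normal form reduction within one degree: a nonstandard monomial is replaced modulo
  \<open>I\<close> by smaller monomials of the same degree. The number of smaller monomials in that
  degree, which is finite, decreases.\<close>

lemma monomial_reduction:
  fixes I :: "('n::{finite,linorder}, 'k::field) mpoly set"
  assumes I: "homogeneous_ideal I" and "mdeg \<alpha> = s"
  shows "\<exists>g. Poly_Mapping.keys g \<subseteq> std_monomials I s \<and> Poly_Mapping.single \<alpha> 1 - g \<in> I"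
  using \<open>mdeg \<alpha> = s\<close>
proof (induction "card {\<beta>. mdeg \<beta> = s \<and> \<beta> \<prec>drl \<alpha>}" arbitrary: \<alpha> rule: less_induct)
  case less
  have ideal: "ideal I poly_ring" using I by (simp add: homogeneous_ideal_def)
  note J = ideal_type_algebraD[OF ideal]
  show ?case
  proof (cases "\<alpha> \<in> LTs I")
    case False
    then have "Poly_Mapping.keys (Poly_Mapping.single \<alpha> (1::'k)) \<subseteq> std_monomials I s"
      using less.prems by (simp add: std_monomials_def)
    then show ?thesis
      using J(1) by (intro exI[of _ "Poly_Mapping.single \<alpha> 1"]) simp
  next
    case True
    then obtain f where f: "f \<in> I" "f \<noteq> 0" "\<alpha> = LT f"
      by (auto simp: LTs_def)
    \<comment> \<open>f itself may be inhomogeneous; its component of degree s still lies in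
      \<open>I\<close> and contains the leading monomial.\<close>
    define p where "p = hom_comp s f"
    have "p \<in> I" using I f(1) by (simp add: homogeneous_ideal_def p_def)
    have keys: "Poly_Mapping.keys p = {\<beta> \<in> Poly_Mapping.keys f. mdeg \<beta> = s}"
      by (simp add: p_def keys_hom_comp)
    have \<alpha>: "\<alpha> \<in> Poly_Mapping.keys p"
      using LT_in_keys[OF f(2)] f(3) less.prems by (simp add: keys)
    define B where "B = Poly_Mapping.keys p - {\<alpha>}"
    have "\<exists>g. Poly_Mapping.keys g \<subseteq> std_monomials I s \<and> Poly_Mapping.single \<beta> 1 - g \<in> I" if "\<beta> \<in> B" for \<beta>
    proof (rule less.hyps)
      have "\<beta> \<prec>drl \<alpha>"
        using that keys_less_LT[OF f(2)] by (simp add: B_def keys f(3))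
      then have "{\<gamma>. mdeg \<gamma> = s \<and> \<gamma> \<prec>drl \<beta>} \<subset> {\<gamma>. mdeg \<gamma> = s \<and> \<gamma> \<prec>drl \<alpha>}"
        using that degrevlex_trans[OF _ \<open>\<beta> \<prec>drl \<alpha>\<close>] degrevlex_irrefl[of \<beta>] by (intro psubsetI) (auto simp: B_def keys)
      moreover have "finite {\<gamma>. mdeg \<gamma> = s \<and> \<gamma> \<prec>drl \<alpha>}"
        by (rule finite_subset[OF _ finite_mdeg_eq[of s]]) blast
      ultimately show "card {\<gamma>. mdeg \<gamma> = s \<and> \<gamma> \<prec>drl \<beta>} < card {\<gamma>. mdeg \<gamma> = s \<and> \<gamma> \<prec>drl \<alpha>}"
        by (intro psubset_card_mono)
    qed (use that in \<open>auto simp: B_def keys\<close>)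
    then obtain G where G: "\<And>\<beta>. \<beta> \<in> B \<Longrightarrow> Poly_Mapping.keys (G \<beta>) \<subseteq> std_monomials I s"
      "\<And>\<beta>. \<beta> \<in> B \<Longrightarrow> Poly_Mapping.single \<beta> 1 - G \<beta> \<in> I"
      by metis
    \<comment> \<open>Solving p for its leading monomial expresses \<alpha> modulo \<open>I\<close>
      through the other monomials with these coefficients.\<close>
    define c where "c \<beta> = - Poly_Mapping.lookup p \<beta> / Poly_Mapping.lookup p \<alpha>" for \<beta>
    define g where "g = (\<Sum>\<beta>\<in>B. Poly_Mapping.single 0 (c \<beta>) * G \<beta>)"
    have "Poly_Mapping.keys (Poly_Mapping.single 0 (c \<beta>) * G \<beta>) \<subseteq> std_monomials I s" if "\<beta> \<in> B" for \<beta>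
      using G(1)[OF that] keys_single_mult[of "c \<beta>" 0 "G \<beta>"] by (cases "c \<beta> = 0") auto
    then have "Poly_Mapping.keys g \<subseteq> std_monomials I s"
      unfolding g_def using Poly_Mapping.keys_sum[of "\<lambda>\<beta>. Poly_Mapping.single 0 (c \<beta>) * G \<beta>" B] by blast
    moreover have "Poly_Mapping.single \<alpha> 1 - g \<in> I"
    proof -
      let ?l = "Poly_Mapping.lookup p \<alpha>"
      have l: "?l \<noteq> 0" using \<alpha> by (simp add: in_keys_iff)
      have "p = Poly_Mapping.single \<alpha> ?l + (\<Sum>\<beta>\<in>B. Poly_Mapping.single \<beta> (Poly_Mapping.lookup p \<beta>))"
        unfolding B_def by (subst mpoly_eq_sum_monomials[of p], subst sum.remove[OF _ \<alpha>]) simp_all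
      then have "Poly_Mapping.single 0 (1 / ?l) * p =
          Poly_Mapping.single 0 (1 / ?l) * (Poly_Mapping.single \<alpha> ?l + (\<Sum>\<beta>\<in>B. Poly_Mapping.single \<beta> (Poly_Mapping.lookup p \<beta>)))"
        by simp
      also have "\<dots> = Poly_Mapping.single \<alpha> 1 - (\<Sum>\<beta>\<in>B. Poly_Mapping.single \<beta> (c \<beta>))"
        using l by (simp add: distrib_left mult_single sum_distrib_left c_def single_uminus sum_negf)
      finally have "Poly_Mapping.single \<alpha> 1 - (\<Sum>\<beta>\<in>B. Poly_Mapping.single \<beta> (c \<beta>)) \<in> I"
        using J(3)[OF \<open>p \<in> I\<close>] by metis
      moreover have "(\<Sum>\<beta>\<in>B. Poly_Mapping.single 0 (c \<beta>) * (Poly_Mapping.single \<beta> 1 - G \<beta>)) \<in> I"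
        using J(3) G(2) by (intro J(5)) (auto simp: B_def)
      \<comment> \<open>The first summand is p made monic; the second replaces each remaining
        monomial by its reduction.\<close>
      ultimately have "(Poly_Mapping.single \<alpha> 1 - (\<Sum>\<beta>\<in>B. Poly_Mapping.single \<beta> (c \<beta>))) +
          (\<Sum>\<beta>\<in>B. Poly_Mapping.single 0 (c \<beta>) * (Poly_Mapping.single \<beta> 1 - G \<beta>)) \<in> I"
        by (rule J(2))
      then show ?thesis
        by (simp add: g_def right_diff_distrib mult_single sum_subtractf)
    qed
    ultimately show ?thesis by blast
  qed
qed

lemma homogeneous_reduction:
  fixes I :: "('n::{finite,linorder}, 'k::field) mpoly set"
  assumes I: "homogeneous_ideal I" and "homogeneous s f"
  shows "\<exists>g. Poly_Mapping.keys g \<subseteq> std_monomials I s \<and> f - g \<in> I"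
proof -
  have ideal: "ideal I poly_ring" using I by (simp add: homogeneous_ideal_def)
  note J = ideal_type_algebraD[OF ideal]
  have "\<exists>g. Poly_Mapping.keys g \<subseteq> std_monomials I s \<and> Poly_Mapping.single \<alpha> 1 - g \<in> I"
    if "\<alpha> \<in> Poly_Mapping.keys f" for \<alpha>
    using assms that by (intro monomial_reduction) (auto simp: homogeneous_def)
  then obtain G where G: "\<And>\<alpha>. \<alpha> \<in> Poly_Mapping.keys f \<Longrightarrow> Poly_Mapping.keys (G \<alpha>) \<subseteq> std_monomials I s"
      "\<And>\<alpha>. \<alpha> \<in> Poly_Mapping.keys f \<Longrightarrow> Poly_Mapping.single \<alpha> 1 - G \<alpha> \<in> I"
    by metis
  let ?c = "Poly_Mapping.lookup f"
  define g where "g = (\<Sum>\<alpha>\<in>Poly_Mapping.keys f. Poly_Mapping.single 0 (?c \<alpha>) * G \<alpha>)"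
  have "Poly_Mapping.keys (Poly_Mapping.single 0 (?c \<alpha>) * G \<alpha>) \<subseteq> std_monomials I s"
    if "\<alpha> \<in> Poly_Mapping.keys f" for \<alpha>
    using G(1)[OF that] keys_single_mult[of "?c \<alpha>" 0 "G \<alpha>"] by (cases "?c \<alpha> = 0") auto
  then have "Poly_Mapping.keys g \<subseteq> std_monomials I s"
    unfolding g_def using Poly_Mapping.keys_sum[of "\<lambda>\<beta>. Poly_Mapping.single 0 (?c \<beta>) * G \<beta>" "Poly_Mapping.keys f"] by blast
  moreover have "(\<Sum>\<alpha>\<in>Poly_Mapping.keys f. Poly_Mapping.single 0 (?c \<alpha>) * (Poly_Mapping.single \<alpha> 1 - G \<alpha>)) \<in> I"
    using J(3) G(2) by (intro J(5)) auto
  then have "f - g \<in> I"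
    by (subst mpoly_eq_sum_monomials[of f]) (simp add: g_def right_diff_distrib mult_single sum_subtractf)
  ultimately show ?thesis by blast
qed

text \<open>The classes of the standard monomials of degree s span the component by
  \<open>homogeneous_reduction\<close> and are independent by
  \<open>std_monomials_independent\<close>.\<close>

lemma hilbert_function_eq_card:
  fixes I :: "('n::{finite,linorder}, 'k::field) mpoly set"
  assumes I: "homogeneous_ideal I" and "I \<noteq> UNIV"
  shows "hilbert_function I s = card (std_monomials I s)"
proof -
  have ideal: "ideal I poly_ring" using I by (simp add: homogeneous_ideal_def)
  note J = ideal_type_algebraD[OF ideal]
  interpret I: ideal I poly_ring by (rule ideal)
  let ?R = "poly_ring Quot I"
  let ?\<pi> = "\<lambda>f. I +>\<^bsub>poly_ring\<^esub> f"
  let ?K = "quot_scalars I"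
  interpret R: ring ?R by (rule I.quotient_is_ring)
  have \<pi>: "?\<pi> \<in> ring_hom poly_ring ?R" by (rule I.rcos_ring_hom)
  have \<pi>_mult: "?\<pi> f \<otimes>\<^bsub>?R\<^esub> ?\<pi> g = ?\<pi> (f * g)" and \<pi>_add: "?\<pi> f \<oplus>\<^bsub>?R\<^esub> ?\<pi> g = ?\<pi> (f + g)" for f g
    using ring_hom_mult[OF \<pi>, of f g] ring_hom_add[OF \<pi>, of f g] by simp_all
  have \<pi>_zero: "\<zero>\<^bsub>?R\<^esub> = ?\<pi> 0"
    by (simp add: FactRing_def coset_type_algebra)
  have \<pi>_one: "\<one>\<^bsub>?R\<^esub> = ?\<pi> 1"
    using ring_hom_one[OF \<pi>] by simp
  have "1 \<notin> I"
    using J(3)[of 1] \<open>I \<noteq> UNIV\<close> by auto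
  \<comment> \<open>The scalars are the image of a field under a ring homomorphism into a ring that
    is nonzero because \<open>I\<close> is proper.\<close>
  have subfield: "subfield ?K ?R"
  proof -
    interpret k: field "ring_of_type_algebra :: 'k ring" ..
    have "(\<lambda>c. Poly_Mapping.single 0 c) \<in> ring_hom (ring_of_type_algebra :: 'k ring) (poly_ring :: ('n, 'k) mpoly ring)"
      by (rule ring_hom_memI) (simp_all add: mult_single single_add)
    then have "?\<pi> \<circ> (\<lambda>c. Poly_Mapping.single 0 c) \<in> ring_hom (ring_of_type_algebra :: 'k ring) ?R"
      using \<pi> by (rule ring_hom_trans)
    then have "ring_hom_ring (ring_of_type_algebra :: 'k ring) ?R (?\<pi> \<circ> (\<lambda>c. Poly_Mapping.single 0 c))"
      by (intro ring_hom_ringI2 k.ring_axioms R.ring_axioms)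
    moreover have "\<one>\<^bsub>?R\<^esub> \<noteq> \<zero>\<^bsub>?R\<^esub>"
      using \<open>1 \<notin> I\<close> coset_eq_iff[OF ideal, of 1 0] by (simp add: \<pi>_zero \<pi>_one)
    ultimately have "subfield ((?\<pi> \<circ> (\<lambda>c. Poly_Mapping.single 0 c)) ` carrier (ring_of_type_algebra :: 'k ring)) ?R"
      using ring_hom_ring.img_is_subfield(2) k.carrier_is_subfield by blast
    moreover have "(?\<pi> \<circ> (\<lambda>c. Poly_Mapping.single 0 c)) ` carrier (ring_of_type_algebra :: 'k ring) = ?K"
      by (auto simp: quot_scalars_def)
    ultimately show ?thesis by simp
  qed
  have "finite (std_monomials I s)"
    unfolding std_monomials_def using finite_mdeg_eq by blast
  \<comment> \<open>\<open>dimension\<close> is inductive and grows by one vector outside the space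
    built so far, so the monomials are added one at a time.\<close>
  have "R.dimension (card A) ?K (?\<pi> ` {f. Poly_Mapping.keys f \<subseteq> A})"
    if "finite A" "A \<subseteq> std_monomials I s" for A
    using that
  proof (induction A rule: finite_induct)
    case empty
    show ?case
      using R.zero_dim[of ?K] by (simp add: \<pi>_zero)
  next
    case (insert \<alpha> A)
    let ?v = "?\<pi> (Poly_Mapping.single \<alpha> 1)" and ?E = "?\<pi> ` {f. Poly_Mapping.keys f \<subseteq> A}"
    have "?v \<notin> ?E"
    proof
      assume "?v \<in> ?E"
      then obtain f where f: "Poly_Mapping.keys f \<subseteq> A" "Poly_Mapping.single \<alpha> 1 - f \<in> I"
        by (auto simp: coset_eq_iff[OF ideal])
      moreover have "Poly_Mapping.keys (Poly_Mapping.single \<alpha> 1 - f) \<subseteq> insert \<alpha> A"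
        using f(1) Poly_Mapping.keys_diff[of "Poly_Mapping.single \<alpha> 1" f] by auto
      ultimately have "Poly_Mapping.single \<alpha> 1 - f = 0"
        using insert.prems by (intro std_monomials_independent[of _ I s]) auto
      then have "Poly_Mapping.keys f = {\<alpha>}"
        by (metis eq_iff_diff_eq_0 keys_single zero_neq_one)
      with f(1) insert.hyps(2) show False by blast
    qed
    moreover have "R.line_extension ?K ?v ?E = ?\<pi> ` {f. Poly_Mapping.keys f \<subseteq> insert \<alpha> A}"
    proof (intro equalityI subsetI)
      fix u assume "u \<in> R.line_extension ?K ?v ?E"
      then obtain c f where "Poly_Mapping.keys f \<subseteq> A"
        "u = ?\<pi> (Poly_Mapping.single 0 c) \<otimes>\<^bsub>?R\<^esub> ?v \<oplus>\<^bsub>?R\<^esub> ?\<pi> f"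
        unfolding R.line_extension_mem_iff quot_scalars_def by blast
      moreover from this have "u = ?\<pi> (Poly_Mapping.single \<alpha> c + f)"
        by (simp add: \<pi>_mult \<pi>_add mult_single)
      moreover have "Poly_Mapping.keys (Poly_Mapping.single \<alpha> c + f) \<subseteq> insert \<alpha> (Poly_Mapping.keys f)"
        using Poly_Mapping.keys_add[of "Poly_Mapping.single \<alpha> c" f] by (auto split: if_splits)
      ultimately show "u \<in> ?\<pi> ` {f. Poly_Mapping.keys f \<subseteq> insert \<alpha> A}"
        by blast
    next
      fix u assume "u \<in> ?\<pi> ` {f. Poly_Mapping.keys f \<subseteq> insert \<alpha> A}"
      then obtain f where f: "Poly_Mapping.keys f \<subseteq> insert \<alpha> A" "u = ?\<pi> f" by blast
      \<comment> \<open>Splitting off the \<alpha>-term leaves a polynomial supported on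
        \<open>A\<close>.\<close>
      define c where "c = Poly_Mapping.lookup f \<alpha>"
      define f' where "f' = f - Poly_Mapping.single \<alpha> c"
      have "Poly_Mapping.lookup f' \<beta> = (if \<beta> = \<alpha> then 0 else Poly_Mapping.lookup f \<beta>)" for \<beta>
        by (simp add: f'_def c_def lookup_minus lookup_single when_def)
      then have "Poly_Mapping.keys f' \<subseteq> A"
        using f(1) by (auto simp: in_keys_iff subset_iff simp del: not_in_keys_iff_lookup_eq_zero split: if_splits)
      moreover have "u = ?\<pi> (Poly_Mapping.single 0 c) \<otimes>\<^bsub>?R\<^esub> ?v \<oplus>\<^bsub>?R\<^esub> ?\<pi> f'"
        by (simp add: \<pi>_mult \<pi>_add mult_single f f'_def)
      ultimately show "u \<in> R.line_extension ?K ?v ?E"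
        unfolding R.line_extension_mem_iff quot_scalars_def by blast
    qed
    ultimately show ?case
      using insert R.Suc_dim[of ?v ?E "card A" ?K] by (simp add: carrier_quot)
  qed
  with \<open>finite (std_monomials I s)\<close> have dim: "R.dimension (card (std_monomials I s)) ?K (?\<pi> ` {f. Poly_Mapping.keys f \<subseteq> std_monomials I s})"
    by blast
  have "?\<pi> ` {f. Poly_Mapping.keys f \<subseteq> std_monomials I s} = quot_comp I s"
  proof (intro equalityI subsetI)
    fix u assume "u \<in> ?\<pi> ` {f. Poly_Mapping.keys f \<subseteq> std_monomials I s}"
    then show "u \<in> quot_comp I s"
      by (auto simp: quot_comp_def homogeneous_def std_monomials_def)
  next
    fix u assume "u \<in> quot_comp I s"
    then obtain f where f: "homogeneous s f" "u = ?\<pi> f"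
      by (auto simp: quot_comp_def)
    obtain g where "Poly_Mapping.keys g \<subseteq> std_monomials I s" "f - g \<in> I"
      using homogeneous_reduction[OF I f(1)] by blast
    then show "u \<in> ?\<pi> ` {f. Poly_Mapping.keys f \<subseteq> std_monomials I s}"
      using f(2) by (auto simp: coset_eq_iff[OF ideal])
  qed
  \<comment> \<open>\<open>dim\<close> is a definite description; uniqueness of the dimension over a
    subfield evaluates it.\<close>
  with dim show ?thesis
    unfolding hilbert_function_def R.dim_def using R.dimension_is_inj[OF subfield]
    by (intro the_equality) auto
qed


section \<open>Hilbert series\<close>

definition expos_of_mdeg :: "'n::{finite,linorder} set \<Rightarrow> nat \<Rightarrow> 'n expo set"
  where "expos_of_mdeg U s = {\<gamma>. Poly_Mapping.keys \<gamma> \<subseteq> U \<and> mdeg \<gamma> = s}"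

definition expo_series :: "'n::{finite,linorder} set \<Rightarrow> rat fps"
  where "expo_series U = Abs_fps (\<lambda>s. of_nat (card (expos_of_mdeg U s)))"

lemma finite_expos_of_mdeg: "finite (expos_of_mdeg U s)"
  unfolding expos_of_mdeg_def by (rule finite_subset[OF _ finite_mdeg_eq[of s]]) blast

lemma mdeg_eq_0_iff [simp]: "mdeg \<alpha> = 0 \<longleftrightarrow> \<alpha> = 0"
  by (auto simp: mdeg_def intro!: poly_mapping_eqI)

lemma mdeg_zero [simp]: "mdeg 0 = 0"
  by simp

lemma expos_of_mdeg_0: "expos_of_mdeg U 0 = {0}"
  by (auto simp: expos_of_mdeg_def)

lemma mdeg_single [simp]: "mdeg (Poly_Mapping.single i k) = k"
  by (simp add: mdeg_def lookup_single when_def)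

text \<open>Either the variable i is absent, or it can be divided out once.\<close>

lemma expos_of_mdeg_insert_Suc:
  "expos_of_mdeg (insert i U) (Suc s) =
    expos_of_mdeg (U - {i}) (Suc s) \<union> (+) (Poly_Mapping.single i 1) ` expos_of_mdeg (insert i U) s"
proof (intro equalityI subsetI)
  fix \<alpha> assume \<alpha>: "\<alpha> \<in> expos_of_mdeg (insert i U) (Suc s)"
  show "\<alpha> \<in> expos_of_mdeg (U - {i}) (Suc s) \<union> (+) (Poly_Mapping.single i 1) ` expos_of_mdeg (insert i U) s"
  proof (cases "i \<in> Poly_Mapping.keys \<alpha>")
    case False
    with \<alpha> show ?thesis by (auto simp: expos_of_mdeg_def)
  next
    case True
    define \<beta> where "\<beta> = \<alpha> - Poly_Mapping.single i 1"
    have eq: "\<alpha> = Poly_Mapping.single i 1 + \<beta>"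
      using True by (intro poly_mapping_eqI)
        (auto simp: \<beta>_def lookup_add lookup_minus lookup_single when_def in_keys_iff)
    have "Poly_Mapping.keys \<beta> \<subseteq> Poly_Mapping.keys \<alpha>"
      by (subst eq) (auto simp: in_keys_iff lookup_add)
    moreover have "mdeg \<beta> = s"
      using \<alpha> by (simp add: expos_of_mdeg_def eq)
    ultimately have "\<beta> \<in> expos_of_mdeg (insert i U) s"
      using \<alpha> by (auto simp: expos_of_mdeg_def)
    then show ?thesis using eq by blast
  qed
next
  fix \<alpha> assume "\<alpha> \<in> expos_of_mdeg (U - {i}) (Suc s) \<union> (+) (Poly_Mapping.single i 1) ` expos_of_mdeg (insert i U) s"
  then show "\<alpha> \<in> expos_of_mdeg (insert i U) (Suc s)"
    using Poly_Mapping.keys_add[of "Poly_Mapping.single i (1::nat)"] by (fastforce simp: expos_of_mdeg_def)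
qed

text \<open>Each variable contributes a factor 1/(1 - X): splitting by occurrence of the variable i
  gives E(U + i) = E(U) + X * E(U + i).\<close>

lemma expo_series_mult:
  fixes U :: "'n::{finite,linorder} set"
  shows "(1 - fps_X) ^ card U * expo_series U = 1"
proof (induction U rule: finite_induct[OF finite])
  case 1
  have "expos_of_mdeg ({} :: 'n set) s = (if s = 0 then {0} else {})" for s
    by (auto simp: expos_of_mdeg_def)
  then show ?case
    by (auto intro!: fps_ext simp: expo_series_def)
next
  case (2 i U)
  have "card (expos_of_mdeg (insert i U) (Suc s)) =
      card (expos_of_mdeg U (Suc s)) + card (expos_of_mdeg (insert i U) s)" for s
  proof -
    have "card (expos_of_mdeg (insert i U) (Suc s)) = card (expos_of_mdeg (U - {i}) (Suc s)) +
        card ((+) (Poly_Mapping.single i 1) ` expos_of_mdeg (insert i U) s)"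
      unfolding expos_of_mdeg_insert_Suc
    proof (rule card_Un_disjoint)
      show "expos_of_mdeg (U - {i}) (Suc s) \<inter> (+) (Poly_Mapping.single i 1) ` expos_of_mdeg (insert i U) s = {}"
      proof -
        have "i \<in> Poly_Mapping.keys (Poly_Mapping.single i 1 + \<beta>)" for \<beta> :: "'n expo"
          by (simp add: in_keys_iff lookup_add)
        then show ?thesis by (auto simp: expos_of_mdeg_def)
      qed
    qed (simp_all add: finite_expos_of_mdeg)
    also have "card ((+) (Poly_Mapping.single i 1) ` expos_of_mdeg (insert i U) s) = card (expos_of_mdeg (insert i U) s)"
      by (intro card_image inj_onI) simp
    finally show ?thesis using 2 by simp
  qed
  then have "expo_series (insert i U) = expo_series U + fps_X * expo_series (insert i U)"
    by (intro fps_ext) (case_tac n, simp_all add: expo_series_def expos_of_mdeg_0)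
  then have "(1 - fps_X) * expo_series (insert i U) = expo_series U"
    by (simp add: algebra_simps)
  moreover have "card (insert i U) = Suc (card U)"
    using 2 by simp
  ultimately show ?case
    using 2 by (simp only: power_Suc2 mult.assoc)
qed

text \<open>Pascal's rule, read off from (1 - X)^(k+1) = (1 - X)^k - X * (1 - X)^k.\<close>

lemma one_minus_fps_X_power_nth:
  "fps_nth ((1 - fps_X) ^ k :: 'a::comm_ring_1 fps) i = (-1) ^ i * of_nat (k choose i)"
proof (induction k arbitrary: i)
  case (Suc k)
  have "(1 - fps_X) ^ Suc k = (1 - fps_X) ^ k - fps_X * (1 - fps_X :: 'a fps) ^ k"
    by (simp add: algebra_simps)
  then show ?case
    by (cases i) (simp_all add: Suc algebra_simps)
next
  case 0
  show ?case by (cases i) simp_all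
qed

lemma power_mult_eq_power_diff:
  fixes x y :: "'a::comm_monoid_mult"
  assumes "x ^ m * y = 1" "m \<le> n"
  shows "x ^ n * y = x ^ (n - m)"
proof -
  have "x ^ n * y = x ^ (n - m) * (x ^ m * y)"
    using assms(2) by (simp flip: power_add mult.assoc)
  then show ?thesis by (simp only: assms(1) mult_1_right)
qed

text \<open>The product is the polynomial (1 - X)^(D - |U|) if |U| \<le> D, and the inverse of (1 -
  X)^(|U| - D) otherwise. This is the origin of the two kinds of binomial coefficients in the final
  formula.\<close>

lemma expo_series_mult_nth:
  "fps_nth ((1 - fps_X) ^ D * expo_series U) i =
    (if card U \<le> D then (-1) ^ i * of_nat ((D - card U) choose i)
     else of_nat ((card U - D + i - 1) choose (card U - D - 1)))"
proof (cases "card U \<le> D")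
  case True
  have "(1 - fps_X) ^ D * expo_series U = (1 - fps_X) ^ (D - card U)"
    by (rule power_mult_eq_power_diff[OF expo_series_mult True])
  with True show ?thesis
    by (simp only: if_True one_minus_fps_X_power_nth)
next
  case False
  define k where "k = card U - D"
  have "k > 0" using False by (simp add: k_def)
  have "(1 - fps_X) ^ k * ((1 - fps_X) ^ D * expo_series U) = 1"
    unfolding mult.assoc[symmetric] power_add[symmetric] k_def
    using False expo_series_mult[of U] by (simp only: add.commute le_add_diff_inverse nat_le_linear not_le less_imp_le)
  then have "(1 - fps_X) ^ D * expo_series U = inverse ((1 - fps_X) ^ k)"
    by (metis fps_inverse_unique mult.commute)
  also have "fps_nth \<dots> i = of_nat ((k + i - 1) choose i)"
    using one_minus_const_fps_X_neg_power'[OF \<open>k > 0\<close>, of "1::rat"] by simp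
  also have "(k + i - 1) choose i = (k + i - 1) choose (k - 1)"
    using \<open>k > 0\<close> by (subst binomial_symmetric) auto
  finally show ?thesis
    using False by (simp add: k_def)
qed

lemma card_cone_mdeg:
  "card {\<beta> \<in> cone \<alpha> U. mdeg \<beta> = s} = (if s < mdeg \<alpha> then 0 else card (expos_of_mdeg U (s - mdeg \<alpha>)))"
proof (cases "s < mdeg \<alpha>")
  case False
  then have "{\<beta> \<in> cone \<alpha> U. mdeg \<beta> = s} = (+) \<alpha> ` expos_of_mdeg U (s - mdeg \<alpha>)"
    by (auto simp: cone_def expos_of_mdeg_def)
  with False show ?thesis
    by (simp add: card_image)
next
  case True
  then have "{\<beta> \<in> cone \<alpha> U. mdeg \<beta> = s} = {}"
    by (auto simp: cone_def)
  then show ?thesis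
    using True by (simp only: card.empty if_True)
qed

text \<open>In each degree the monomials split into the standard ones, counted by the Hilbert
  function, and the leading ones, which the disjoint cones of \<open>H\<close> exhaust.\<close>

lemma hilbert_series_pommaret_basis:
  fixes I H :: "('n::{finite,linorder}, 'k::field) mpoly set"
  assumes I: "homogeneous_ideal I" "I \<noteq> UNIV" and H: "pommaret_basis H I"
  shows "hilbert_series I = expo_series (UNIV :: 'n set) -
    (\<Sum>h\<in>H. fps_X ^ mdeg (LT h) * expo_series (mult_vars h))"
proof (rule fps_ext)
  fix s
  have ideal: "ideal I poly_ring" using I by (simp add: homogeneous_ideal_def)
  have "finite H" using H by (simp add: pommaret_basis_def)
  let ?C = "\<lambda>h. {\<beta> \<in> cone (LT h) (mult_vars h). mdeg \<beta> = s}"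
  note cones = pommaret_basis_cones[OF ideal H]
  have fin: "finite {\<beta> \<in> A. mdeg \<beta> = s}" for A :: "'n expo set"
    by (rule finite_subset[OF _ finite_mdeg_eq[of s]]) blast
  have "expos_of_mdeg (UNIV :: 'n set) s = std_monomials I s \<union> {\<alpha> \<in> LTs I. mdeg \<alpha> = s}"
    by (auto simp: std_monomials_def expos_of_mdeg_def)
  then have "card (expos_of_mdeg (UNIV :: 'n set) s) = card (std_monomials I s \<union> {\<alpha> \<in> LTs I. mdeg \<alpha> = s})"
    by (rule arg_cong)
  also have "\<dots> = card (std_monomials I s) + card {\<alpha> \<in> LTs I. mdeg \<alpha> = s}"
  proof (rule card_Un_disjoint)
    show "finite (std_monomials I s)"
      unfolding std_monomials_def using finite_mdeg_eq by (rule finite_Diff)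
  qed (use fin in \<open>auto simp: std_monomials_def\<close>)
  also have "{\<alpha> \<in> LTs I. mdeg \<alpha> = s} = (\<Union>h\<in>H. ?C h)"
    using cones(2) by blast
  also have "card \<dots> = (\<Sum>h\<in>H. card (?C h))"
    using cones(1) fin \<open>finite H\<close> by (intro card_UN_disjoint) (auto simp: disjoint_family_on_def)
  finally have "card (expos_of_mdeg (UNIV :: 'n set) s) = hilbert_function I s + (\<Sum>h\<in>H. card (?C h))"
    by (simp only: hilbert_function_eq_card[OF I])
  then have "fps_nth (expo_series (UNIV :: 'n set)) s = fps_nth (hilbert_series I) s + (\<Sum>h\<in>H. of_nat (card (?C h)))"
    by (simp add: expo_series_def hilbert_series_def)
  also have "(\<Sum>h\<in>H. of_nat (card (?C h))) = fps_nth (\<Sum>h\<in>H. fps_X ^ mdeg (LT h) * expo_series (mult_vars h)) s"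
    by (simp add: fps_sum_nth fps_X_power_mult_nth expo_series_def card_cone_mdeg if_distrib cong: if_cong)
  finally show "fps_nth (hilbert_series I) s = fps_nth (expo_series (UNIV :: 'n set) -
    (\<Sum>h\<in>H. fps_X ^ mdeg (LT h) * expo_series (mult_vars h))) s"
    by simp
qed

section \<open>The numerator of the Hilbert series\<close>

lemma poly_deg_homogeneous:
  assumes "f \<noteq> 0" "homogeneous s f"
  shows "poly_deg f = mdeg (LT f)"
proof -
  have "mdeg ` Poly_Mapping.keys f = {mdeg (LT f)}"
    using assms LT_in_keys[OF assms(1)] by (auto simp: homogeneous_def)
  then show ?thesis by (simp add: poly_deg_def)
qed

lemma fps_of_poly_one_minus: "fps_of_poly [:1, - 1:] = (1 - fps_X :: 'a::comm_ring_1 fps)"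
  by (rule fps_ext) (simp add: coeff_pCons fps_X_def split: nat.split)

text \<open>The left side of the equation has degree e = deg N + n - D. If deg N exceeded the
  maximum, every summand on the right would have degree below e, so the leading coefficient on the
  left would vanish.\<close>

lemma degree_numerator_le:
  fixes N :: "'a::idom poly"
  assumes "N \<noteq> 0" "D < n" "finite H" "H \<noteq> {}" "\<And>h. h \<in> H \<Longrightarrow> m h \<le> n"
    and eq: "N * [:1, -1:] ^ (n - D) = 1 - (\<Sum>h\<in>H. Polynomial.monom 1 (d h) * [:1, -1:] ^ (n - m h))"
  shows "int (Polynomial.degree N) \<le> Max {int (d h) - int (m h) + int D | h. h \<in> H}"
proof (rule ccontr)
  let ?S = "{int (d h) - int (m h) + int D | h. h \<in> H}"
  assume *: "\<not> int (Polynomial.degree N) \<le> Max ?S"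
  have S: "?S = (\<lambda>h. int (d h) - int (m h) + int D) ` H"
    by blast
  define e where "e = Polynomial.degree N + (n - D)"
  have "d h + (n - m h) < e" if "h \<in> H" for h
  proof -
    have "int (d h) - int (m h) + int D \<le> Max ?S"
      unfolding S using that \<open>finite H\<close> by (intro Max_ge) auto
    with * assms(2) assms(5)[OF that] show ?thesis
      unfolding e_def by linarith
  qed
  moreover have "Polynomial.degree (Polynomial.monom (1::'a) (d h) * [:1, -1:] ^ (n - m h)) \<le> d h + (n - m h)" for h
    by (rule order_trans[OF degree_mult_le]) (simp add: degree_monom_eq degree_power_eq)
  ultimately have "Polynomial.coeff (Polynomial.monom (1::'a) (d h) * [:1, -1:] ^ (n - m h)) e = 0" if "h \<in> H" for h
    using that by (intro coeff_eq_0) (meson le_less_trans)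
  \<comment> \<open>D < n makes e positive, so the constant 1 contributes nothing to this
    coefficient.\<close>
  then have "Polynomial.coeff (N * [:1, -1:] ^ (n - D)) e = 0"
    using \<open>D < n\<close> by (simp add: eq coeff_sum e_def)
  moreover have "Polynomial.degree (N * [:1, -1:] ^ (n - D)) = e"
    using \<open>N \<noteq> 0\<close> by (simp add: degree_mult_eq degree_power_eq e_def)
  ultimately have "N * [:1, -1:] ^ (n - D) = 0"
    by (metis leading_coeff_0_iff)
  with \<open>N \<noteq> 0\<close> show False by simp
qed

theorem proposition3p3:
  fixes I H :: "('n::{finite,linorder}, 'k::field) mpoly set"
    and D :: nat and N :: "rat poly"
  assumes "infinite (UNIV :: 'k set)"
    and "homogeneous_ideal I" and "I \<noteq> {0}" and "I \<noteq> UNIV"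
    and "ideal_dim I = enat D"
    and "pommaret_basis H I"
    and "hilbert_series I = fps_of_poly N / (1 - fps_X) ^ D"
  shows "int (Polynomial.degree N) \<le>
           Max {int (poly_deg h) - int (card (mult_vars h)) + int D | h. h \<in> H} \<and>
         (\<forall>i\<le>Polynomial.degree N. Polynomial.coeff N i =
           of_nat ((CARD('n) - D + i - 1) choose (CARD('n) - D - 1))
           - (\<Sum>h\<in>{h \<in> H. poly_deg h \<le> i \<and> card (mult_vars h) \<le> D}.
                (-1) ^ (i - poly_deg h) * of_nat ((D - card (mult_vars h)) choose (i - poly_deg h)))
           - (\<Sum>h\<in>{h \<in> H. poly_deg h \<le> i \<and> D < card (mult_vars h)}.
                of_nat ((card (mult_vars h) - D + i - poly_deg h - 1)
                        choose (card (mult_vars h) - D - 1))))"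
proof
  let ?n = "CARD('n)"
  let ?d = "poly_deg" and ?m = "\<lambda>h. card (mult_vars h)"
  have ideal: "ideal I poly_ring" using assms(2) by (simp add: homogeneous_ideal_def)
  have "D < ?n"
    using ideal_dim_less[OF ideal assms(3,5)] .
  have "finite H" using assms(6) by (simp add: pommaret_basis_def)
  have m: "?m h \<le> ?n" for h :: "('n, 'k) mpoly"
    by (rule card_mono) auto
  have d: "mdeg (LT h) = ?d h" if "h \<in> H" for h
    using that assms(6) poly_deg_homogeneous unfolding pommaret_basis_def by metis
  have HS: "hilbert_series I = expo_series (UNIV :: 'n set) - (\<Sum>h\<in>H. fps_X ^ ?d h * expo_series (mult_vars h))"
    using hilbert_series_pommaret_basis[OF assms(2,4,6)] d by simp
  \<comment> \<open>(1 - X)^D has constant term 1, so it is a unit and the division can be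
    undone.\<close>
  have N: "fps_of_poly N = (1 - fps_X) ^ D * hilbert_series I"
    unfolding assms(7)
    by (subst fps_divide_unit) (simp_all add: fps_nth_power_0 inverse_mult_eq_1' mult.left_commute)
  have N_sum: "fps_of_poly N = (1 - fps_X) ^ D * expo_series (UNIV :: 'n set) -
      (\<Sum>h\<in>H. fps_X ^ ?d h * ((1 - fps_X) ^ D * expo_series (mult_vars h)))"
    unfolding N HS by (simp add: right_diff_distrib sum_distrib_left mult_ac)
  show "int (Polynomial.degree N) \<le> Max {int (?d h) - int (?m h) + int D | h. h \<in> H}"
  proof (rule degree_numerator_le[OF _ \<open>D < ?n\<close> \<open>finite H\<close> _ m])
    \<comment> \<open>As \<open>I\<close> is proper, 1 is a standard monomial; hence the Hilbert
      series and \<open>N\<close> are nonzero.\<close>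
    have "0 \<in> std_monomials I 0"
      using zero_notin_LTs[OF ideal assms(4)] by (simp add: std_monomials_def)
    moreover have "finite (std_monomials I 0)"
      unfolding std_monomials_def using finite_mdeg_eq by blast
    ultimately have "hilbert_function I 0 \<noteq> 0"
      by (auto simp: hilbert_function_eq_card[OF assms(2,4)])
    then have "hilbert_series I \<noteq> 0"
      by (auto simp: hilbert_series_def fps_eq_iff)
    then show "N \<noteq> 0"
      using assms(7) by auto
    \<comment> \<open>A nonzero element of \<open>I\<close> has its leading exponent in some cone,
      so \<open>H\<close> is nonempty and the maximum is taken over a nonempty set.\<close>
    obtain f where "f \<in> I" "f \<noteq> 0"
      using ideal_type_algebraD(1)[OF ideal] assms(3) by auto
    then have "LT f \<in> LTs I" by (auto simp: LTs_def)
    then show "H \<noteq> {}"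
      using pommaret_basis_cones(2)[OF ideal assms(6)] by auto
    \<comment> \<open>Multiplication by (1 - X)^n clears all denominators, since no h has more than
      n multiplicative variables.\<close>
    have "fps_of_poly (N * [:1, -1:] ^ (?n - D)) = (1 - fps_X) ^ (?n - D) * ((1 - fps_X) ^ D * hilbert_series I)"
      by (simp add: fps_of_poly_mult fps_of_poly_power fps_of_poly_one_minus N mult_ac)
    also have "\<dots> = (1 - fps_X) ^ ?n * hilbert_series I"
      using \<open>D < ?n\<close> by (simp flip: power_add mult.assoc)
    also have "\<dots> = 1 - (\<Sum>h\<in>H. fps_X ^ ?d h * ((1 - fps_X) ^ ?n * expo_series (mult_vars h)))"
      unfolding HS using expo_series_mult[of "UNIV :: 'n set"]
      by (simp add: right_diff_distrib sum_distrib_left mult_ac)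
    also have "\<dots> = 1 - (\<Sum>h\<in>H. fps_X ^ ?d h * (1 - fps_X) ^ (?n - ?m h))"
    proof -
      have "(1 - fps_X) ^ ?n * expo_series (mult_vars h) = (1 - fps_X) ^ (?n - ?m h)" for h :: "('n, 'k) mpoly"
        by (rule power_mult_eq_power_diff[OF expo_series_mult m])
      then show ?thesis by (simp only:)
    qed
    also have "\<dots> = fps_of_poly (1 - (\<Sum>h\<in>H. Polynomial.monom 1 (?d h) * [:1, -1:] ^ (?n - ?m h)))"
      by (simp add: fps_of_poly_diff fps_of_poly_sum fps_of_poly_mult fps_of_poly_power fps_of_poly_one_minus fps_of_poly_monom')
    finally show "N * [:1, -1:] ^ (?n - D) = 1 - (\<Sum>h\<in>H. Polynomial.monom 1 (?d h) * [:1, -1:] ^ (?n - ?m h))"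
      by (simp only: fps_of_poly_eq_iff)
  qed
  show "\<forall>i\<le>Polynomial.degree N. Polynomial.coeff N i =
      of_nat ((?n - D + i - 1) choose (?n - D - 1))
      - (\<Sum>h\<in>{h \<in> H. ?d h \<le> i \<and> ?m h \<le> D}. (-1) ^ (i - ?d h) * of_nat ((D - ?m h) choose (i - ?d h)))
      - (\<Sum>h\<in>{h \<in> H. ?d h \<le> i \<and> D < ?m h}. of_nat ((?m h - D + i - ?d h - 1) choose (?m h - D - 1)))"
  proof (intro allI impI)
    fix i
    \<comment> \<open>Here \<open>i - ?d h\<close> is bracketed, as the shift by
      \<open>fps_X ^ ?d h\<close> produces it; on the range \<open>?d h \<le> i\<close> this agrees
      with the truncated subtraction in the claim.\<close>
    let ?c = "\<lambda>h. if ?m h \<le> D then (-1) ^ (i - ?d h) * of_nat ((D - ?m h) choose (i - ?d h))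
        else of_nat ((?m h - D + (i - ?d h) - 1) choose (?m h - D - 1)) :: rat"
    have "Polynomial.coeff N i = fps_nth (fps_of_poly N) i"
      by simp
    \<comment> \<open>By D < n, the series of all monomials falls under the second case of
      \<open>expo_series_mult_nth\<close>.\<close>
    also have "\<dots> = of_nat ((?n - D + i - 1) choose (?n - D - 1)) - (\<Sum>h\<in>H. if i < ?d h then 0 else ?c h)"
      using \<open>D < ?n\<close>
      by (simp only: N_sum fps_sub_nth fps_sum_nth fps_X_power_mult_nth expo_series_mult_nth not_le[symmetric] if_False)
    also have "(\<Sum>h\<in>H. if i < ?d h then 0 else ?c h) = (\<Sum>h\<in>{h \<in> H. ?d h \<le> i}. ?c h)"
      using \<open>finite H\<close> by (subst sum.inter_filter) (auto intro!: sum.cong)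
    also have "\<dots> = (\<Sum>h\<in>{h \<in> H. ?d h \<le> i \<and> ?m h \<le> D}. ?c h) + (\<Sum>h\<in>{h \<in> H. ?d h \<le> i \<and> D < ?m h}. ?c h)"
      using \<open>finite H\<close> by (subst sum.union_disjoint[symmetric]) (auto intro!: sum.cong)
    also have "(\<Sum>h\<in>{h \<in> H. ?d h \<le> i \<and> ?m h \<le> D}. ?c h) =
        (\<Sum>h\<in>{h \<in> H. ?d h \<le> i \<and> ?m h \<le> D}. (-1) ^ (i - ?d h) * of_nat ((D - ?m h) choose (i - ?d h)))"
      by (intro sum.cong) auto
    also have "(\<Sum>h\<in>{h \<in> H. ?d h \<le> i \<and> D < ?m h}. ?c h) =
        (\<Sum>h\<in>{h \<in> H. ?d h \<le> i \<and> D < ?m h}. of_nat ((?m h - D + i - ?d h - 1) choose (?m h - D - 1)))"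
      by (intro sum.cong) auto
    finally show "Polynomial.coeff N i = of_nat ((?n - D + i - 1) choose (?n - D - 1))
      - (\<Sum>h\<in>{h \<in> H. ?d h \<le> i \<and> ?m h \<le> D}. (-1) ^ (i - ?d h) * of_nat ((D - ?m h) choose (i - ?d h)))
      - (\<Sum>h\<in>{h \<in> H. ?d h \<le> i \<and> D < ?m h}. of_nat ((?m h - D + i - ?d h - 1) choose (?m h - D - 1)))"
      by simp
  qed
qed

end
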